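(* Assume that $a_{ij}>0$ for all $i\in N$, $j\in M$ (MAC). Consider the following algorithm on the graph $\mathcal G=(V,E)$. Beginning: start from any $v^0\in V$. Body: for the current $v^k\in V$, compute the directional derivative $\frac{dg}{d\vec\ell}$ (defined in the context) towards each adjacent vertex. If $\frac{dg}{d\vec\ell}\ge0$ towards every adjacent vertex, then $v^k$ is declared optimal and the algorithm goes to the End step; if $\frac{dg}{d\vec\ell}<0$ towards some adjacent vertex, move to the adjacent vertex $v^{k+1}$ with the lowest derivative and repeat the step with $v^{k+1}$. End: from the optimal vertex/face, find the optimal allocation. Then the algorithm converges in a finite number of steps, i.e. it stops after finitely many steps at an optimal vertex (one whose Pareto face contains a point of the egalitarian ray).
   Context: Setting. $N=\{1,2,3\}$ is the set of players and $M=\{1,\dots,m\}$ the set of divisible homogeneous goods (items). $a_{ij}$ is the value of good $j$ to player $i$, with $\sum_{j\in M}a_{ij}=1$ for each $i$. An allocation is a matrix $\mathbf X=(x_{ij})$ with $x_{ij}\ge0$ and $\sum_{i\in N}x_{ij}=1$ for all $j$. Put $a_i(\mathbf X)=\sum_{j}a_{ij}x_{ij}$ and $a(\mathbf X)=(a_i(\mathbf X))_{i\in N}$. $IPS=\{a(\mathbf X):\mathbf X\text{ an allocation}\}\subset\mathbb R^3$. The egalitarian ray is $\{t(1,1,1):t\ge0\}$. The optimal allocation is the Pareto optimal allocation with $a_1(\mathbf X)=a_2(\mathbf X)=a_3(\mathbf X)$. $\Delta_2=\{x\in\mathbb R^3: x_i\ge0,\ x_1+x_2+x_3=1\}$; $\mathring\Delta_2$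 is the subset with all $x_i>0$. For nonzero $x\in\mathbb R^3_+$, $N(x)=x/(x_1+x_2+x_3)$; for $x\in\mathring\Delta_2$, $RD(x)=N(1/x_1,1/x_2,1/x_3)$. For $\gamma\in\Delta_2$, $g(\gamma)=\max_{y\in IPS}\sum_i\gamma_iy_i$ and $\mathcal H(\gamma)=\{x:\sum_i\gamma_ix_i=g(\gamma)\}$. For $\beta\in\mathring\Delta_2$, $\tilde g(\beta)=g(RD(\beta))$. $RNS$ is the simplex $\Delta_2$, in which the vertex $e_i$ represents player $i$ and each good $j$ is plotted at $a^n_j=N(a_{1j},a_{2j},a_{3j})$. The supporting segments of a good $j$ are the three segments joining $a^n_j$ to the vertices of the simplex. The disputing segments of a point $c$ are the three segments on the lines joining $c$ with each vertex, from $c$ (excluded) to the side opposite to that vertex. They divide the simplex into three parts, each a neighborhood of a vertex; the Pareto Allocation Rule $PAR(c)$ assigns the goods in each part to the player of that vertex. A good on a disputing segment is disputed between the two players whose parts are separated by that segment, and a good located at $c$ is disputed among all three players. The graph $\mathcal G=(V,E)$: $V$ is the set of points in the interior of $RNS$ that coincide with some $a^n_j$ or are an intersection point of supporting segments of two s-independent goods (two goods are s-independent if neither of their plotted points lies on a supporting segment of the other). Two points of $V$ are joined by an arc (are adjacent) if there is a supporting segment joining them with no other point of $V$ in between. Each $v\in V$ represents the Pareto face $IPS\cap\mathcal H(RD(v))$. Directional derivative. Let $c=(c_1,c_2,c_3)\in V$. Let $dg(c)$ be the set of goods disputed at $c$, let $dp(j)$ be the set of players disputing good $j\in dg(c)$,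 and let $a_i(\mathbf X_i^-)$ be the value to player $i$ of the goods that $PAR(c)$ allocates to $i$ without dispute. For a shift $s=(s_1,s_2,s_3)$ of the hyperplane coefficients, with $s_1+s_2+s_3=0$, put $$\Delta\tilde g=\sum_{i\in N}s_i\,a_i(\mathbf X_i^-)+\sum_{j\in dg(c)}\max_{i\in dp(j)}\{s_ia_{ij}\}.$$ The directional derivative $\frac{dg}{d\vec\ell}$ at $c$ in the direction $\vec\ell$ towards the vertex of player 1 is the value of $\Delta\tilde g$ for $$s=\delta'(0)\,(-c_2-c_3,\;c_2,\;c_3),\qquad \delta'(0)=\frac{c_2c_3}{(c_2+c_3)\,(c_2c_3+c_1(c_2+c_3))^2}.$$ In the opposite direction (along the same line, away from the vertex of player 1) it is the value of $\Delta\tilde g$ for the shift with all signs reversed. For the directions along the lines through $c$ and the vertex of player 2 (respectively 3), the role of $c_1$ is exchanged with that of $c_2$ (respectively $c_3$). The derivative towards an adjacent vertex is the one in the corresponding direction.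
   Formalization: The shift in the directional derivative is taken as δ'(0)(−c2−c3, c3, c2), not the printed δ'(0)(−c2−c3, c2, c3) (likewise for players 2 and 3); with the printed order the algorithm can stop at a non-optimal vertex. *)

theory Defs
  imports "HOL-Analysis.Analysis"
begin

text \<open>Players are the elements of the type \<open>3\<close>, goods those of a finite type \<open>'m\<close>;
  \<open>a $ i $ j\<close> is the value of good \<open>j\<close> to player \<open>i\<close>, and \<open>X $ i $ j\<close> the
  fraction of good \<open>j\<close> given to player \<open>i\<close>.\<close>

definition allocation :: "real^'m^3 \<Rightarrow> bool" where
  "allocation X \<longleftrightarrow> (\<forall>i j. 0 \<le> X $ i $ j) \<and> (\<forall>j. (\<Sum>i\<in>UNIV. X $ i $ j) = 1)"

definition alloc_value :: "real^'m^3 \<Rightarrow> real^'m^3 \<Rightarrow> real^3" where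
  "alloc_value a X = (\<chi> i. \<Sum>j\<in>UNIV. a $ i $ j * X $ i $ j)"

definition IPS :: "real^'m^3 \<Rightarrow> (real^3) set" where
  "IPS a = {alloc_value a X | X. allocation X}"

definition egalitarian_ray :: "(real^3) set" where
  "egalitarian_ray = {\<chi> i. t | t. 0 \<le> t}"

definition pareto_optimal :: "real^'m^3 \<Rightarrow> real^'m^3 \<Rightarrow> bool" where
  "pareto_optimal a X \<longleftrightarrow> allocation X \<and>
     \<not> (\<exists>Y. allocation Y \<and> (\<forall>i. alloc_value a X $ i \<le> alloc_value a Y $ i) \<and>
          (\<exists>i. alloc_value a X $ i < alloc_value a Y $ i))"

definition optimal_allocation :: "real^'m^3 \<Rightarrow> real^'m^3 \<Rightarrow> bool" where
  "optimal_allocation a X \<longleftrightarrow>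
     pareto_optimal a X \<and> (\<forall>i k. alloc_value a X $ i = alloc_value a X $ k)"

definition RNS :: "(real^3) set" where
  "RNS = {x. (\<forall>i. 0 \<le> x $ i) \<and> (\<Sum>i\<in>UNIV. x $ i) = 1}"

definition RNS_interior :: "(real^3) set" where
  "RNS_interior = {x \<in> RNS. \<forall>i. 0 < x $ i}"

abbreviation player_vertex :: "3 \<Rightarrow> real^3" where
  "player_vertex i \<equiv> axis i 1"

definition normalized :: "real^3 \<Rightarrow> real^3" where
  "normalized x = (\<chi> i. x $ i / (\<Sum>k\<in>UNIV. x $ k))"

definition RD :: "real^3 \<Rightarrow> real^3" where
  "RD x = normalized (\<chi> i. 1 / x $ i)"

text \<open>The supremum is a maximum, since \<open>IPS a\<close> is compact and nonempty.\<close>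

definition support_fun :: "real^'m^3 \<Rightarrow> real^3 \<Rightarrow> real" where
  "support_fun a \<gamma> = (SUP y\<in>IPS a. \<Sum>i\<in>UNIV. \<gamma> $ i * y $ i)"

definition support_hyperplane :: "real^'m^3 \<Rightarrow> real^3 \<Rightarrow> (real^3) set" where
  "support_hyperplane a \<gamma> = {x. (\<Sum>i\<in>UNIV. \<gamma> $ i * x $ i) = support_fun a \<gamma>}"

definition pareto_face :: "real^'m^3 \<Rightarrow> real^3 \<Rightarrow> (real^3) set" where
  "pareto_face a v = IPS a \<inter> support_hyperplane a (RD v)"

definition good_point :: "real^'m^3 \<Rightarrow> 'm \<Rightarrow> real^3" where
  "good_point a j = normalized (\<chi> i. a $ i $ j)"

definition supporting_segment :: "real^'m^3 \<Rightarrow> 'm \<Rightarrow> 3 \<Rightarrow> (real^3) set" where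
  "supporting_segment a j i = closed_segment (good_point a j) (player_vertex i)"

definition s_independent :: "real^'m^3 \<Rightarrow> 'm \<Rightarrow> 'm \<Rightarrow> bool" where
  "s_independent a j k \<longleftrightarrow>
     (\<forall>i. good_point a j \<notin> supporting_segment a k i \<and>
          good_point a k \<notin> supporting_segment a j i)"

definition graph_verts :: "real^'m^3 \<Rightarrow> (real^3) set" where
  "graph_verts a = {v \<in> RNS_interior. (\<exists>j. v = good_point a j) \<or>
     (\<exists>j k. s_independent a j k \<and>
        (\<exists>i l. v \<in> supporting_segment a j i \<inter> supporting_segment a k l))}"

definition graph_adj :: "real^'m^3 \<Rightarrow> real^3 \<Rightarrow> real^3 \<Rightarrow> bool" where
  "graph_adj a v w \<longleftrightarrow> v \<in> graph_verts a \<and> w \<in> graph_verts a \<and> v \<noteq> w \<and>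
     (\<exists>j i. v \<in> supporting_segment a j i \<and> w \<in> supporting_segment a j i) \<and>
     graph_verts a \<inter> open_segment v w = {}"

definition disputing_segment :: "real^3 \<Rightarrow> 3 \<Rightarrow> (real^3) set" where
  "disputing_segment c i = {x. \<exists>p\<in>RNS. p $ i = 0 \<and>
     c \<in> closed_segment (player_vertex i) p \<and> x \<in> closed_segment c p - {c}}"

definition PAR_part :: "real^3 \<Rightarrow> 3 \<Rightarrow> (real^3) set" where
  "PAR_part c i =
     connected_component_set (RNS - insert c (\<Union>k. disputing_segment c k)) (player_vertex i)"

text \<open>The disputing segment on the line through the vertex of player \<open>i\<close> ends on the side
  opposite to that vertex, hence it separates the parts of the two players other than \<open>i\<close>.\<close>

definition disputing_players :: "real^'m^3 \<Rightarrow> real^3 \<Rightarrow> 'm \<Rightarrow> 3 set" where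
  "disputing_players a c j =
     (if good_point a j = c then UNIV
      else {k. \<exists>i. i \<noteq> k \<and> good_point a j \<in> disputing_segment c i})"

definition disputed_goods :: "real^'m^3 \<Rightarrow> real^3 \<Rightarrow> 'm set" where
  "disputed_goods a c =
     {j. good_point a j = c \<or> (\<exists>i. good_point a j \<in> disputing_segment c i)}"

definition undisputed_value :: "real^'m^3 \<Rightarrow> real^3 \<Rightarrow> 3 \<Rightarrow> real" where
  "undisputed_value a c i = (\<Sum>j | good_point a j \<in> PAR_part c i. a $ i $ j)"

definition delta_g :: "real^'m^3 \<Rightarrow> real^3 \<Rightarrow> real^3 \<Rightarrow> real" where
  "delta_g a c s = (\<Sum>i\<in>UNIV. s $ i * undisputed_value a c i) +
     (\<Sum>j\<in>disputed_goods a c. Max ((\<lambda>i. s $ i * a $ i $ j) ` disputing_players a c j))"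

definition shift_rate :: "real^3 \<Rightarrow> 3 \<Rightarrow> real" where
  "shift_rate c i = (let \<sigma> = (\<Sum>k\<in>-{i}. c $ k); \<pi> = (\<Prod>k\<in>-{i}. c $ k)
     in \<pi> / (\<sigma> * (\<pi> + c $ i * \<sigma>)\<^sup>2))"

text \<open>The velocity of the hyperplane coefficients \<open>RD c\<close> when \<open>c\<close> moves towards the vertex of
  player \<open>i\<close>. For \<open>i = 1\<close> it is \<open>shift_rate c 1\<close> times \<open>(- c\<^sub>2 - c\<^sub>3, c\<^sub>3, c\<^sub>2)\<close>. The order of the
  last two entries matters: \<open>c\<^sub>2 : c\<^sub>3\<close> is constant on the line through \<open>c\<close> and that vertex,
  so the coefficients of players 2 and 3, being proportional to \<open>1 / c\<^sub>2\<close> and \<open>1 / c\<^sub>3\<close>, keep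
  the ratio \<open>c\<^sub>3 : c\<^sub>2\<close>. With \<open>(- c\<^sub>2 - c\<^sub>3, c\<^sub>2, c\<^sub>3)\<close> instead, the coefficients would leave the
  image of that line under \<open>RD\<close> unless \<open>c\<^sub>2 = c\<^sub>3\<close>. See lemma \<open>RD_velocity\<close>.\<close>

definition vertex_shift :: "real^3 \<Rightarrow> 3 \<Rightarrow> real^3" where
  "vertex_shift c i = (\<chi> k. shift_rate c i *
     (if k = i then - (\<Sum>l\<in>-{i}. c $ l) else (\<Prod>l\<in>-{i, k}. c $ l)))"

lemma RD_velocity_real:
  fixes x y z :: real
  assumes p: "0 < x" "0 < y" "0 < z" and s: "x + y + z = 1"
  defines "S \<equiv> \<lambda>t. 1 / (x + t) + 1 / (y - t * y / (y + z)) + 1 / (z - t * z / (y + z))"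
    and "d \<equiv> y * z / ((y + z) * (y * z + x * (y + z))\<^sup>2)"
  shows "((\<lambda>t. 1 / (x + t) / S t) has_real_derivative - d * (y + z)) (at 0)" (is ?A)
    and "((\<lambda>t. 1 / (y - t * y / (y + z)) / S t) has_real_derivative d * z) (at 0)" (is ?B)
    and "((\<lambda>t. 1 / (z - t * z / (y + z)) / S t) has_real_derivative d * y) (at 0)" (is ?C)
proof -
  define Q where "Q = (\<lambda>t. (1 - t / (y + z)) * (y * z) + (x + t) * (y + z))"
  define q where "q = y * z + x * (y + z)"
  have q: "q > 0" using p unfolding q_def by (simp add: add_pos_pos)
  have yz: "y + z > 0" and x: "x = 1 - (y + z)" using p s by linarith+
  have Q0: "Q 0 = q" "Q 0 \<noteq> 0" using q by (auto simp: Q_def q_def)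
  have dQ: "(Q has_real_derivative (y + z) - y * z / (y + z)) (at 0)"
    unfolding Q_def using yz by (auto intro!: derivative_eq_intros)
  have tr: "(h has_real_derivative D) (at 0)"
    if "(g has_real_derivative D) (at 0)" "\<And>t. 0 < x + t \<Longrightarrow> 0 < 1 - t / (y + z) \<Longrightarrow> g t = h t"
    for g h D
  proof (rule has_field_derivative_transform_within_open[OF that(1)])
    show "open {-x <..< y + z}" "0 \<in> {-x <..< y + z}" using p by auto
    show "g t = h t" if "t \<in> {-x <..< y + z}" for t
      using that yz \<open>\<And>t. 0 < x + t \<Longrightarrow> 0 < 1 - t / (y + z) \<Longrightarrow> g t = h t\<close>[of t] by auto
  qed
  have SQ: "S t = Q t / ((x + t) * (1 - t / (y + z)) * y * z)"
    and w: "y - t * y / (y + z) = y * (1 - t / (y + z))"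
           "z - t * z / (y + z) = z * (1 - t / (y + z))"
    if t: "0 < x + t" "0 < 1 - t / (y + z)" for t
  proof -
    define w where "w = 1 - t / (y + z)"
    show *: "y - t * y / (y + z) = y * (1 - t / (y + z))"
         "z - t * z / (y + z) = z * (1 - t / (y + z))" by (simp_all add: algebra_simps)
    show "S t = Q t / ((x + t) * (1 - t / (y + z)) * y * z)"
      unfolding S_def Q_def * using t p unfolding w_def[symmetric]
      by (simp add: divide_simps) (simp add: algebra_simps)
  qed
  have d: "d = y * z / ((y + z) * q\<^sup>2)" by (simp add: d_def q_def)
  have e: "(- 1 / (y + z) * (y * z) * q - y * z * ((y + z) - y * z / (y + z))) / q\<^sup>2 = - d * (y + z)"
  proof -
    have "- 1 / (y + z) * (y * z) * q - y * z * ((y + z) - y * z / (y + z))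
       = - (y * z) / (y + z) * (q + (y + z)\<^sup>2 - y * z)"
      using yz by (simp add: divide_simps) (simp add: power2_eq_square algebra_simps)
    also have "q + (y + z)\<^sup>2 - y * z = (y + z) * 1"
      unfolding q_def s[symmetric] by (simp add: power2_eq_square algebra_simps)
    finally show ?thesis using yz q by (simp add: d)
  qed
  have e': "(q - x * ((y + z) - y * z / (y + z))) / q\<^sup>2 = d"
  proof -
    have "q - x * ((y + z) - y * z / (y + z)) = y * z * (x + y + z) / (y + z)"
      using yz by (simp add: q_def divide_simps) (simp add: power2_eq_square algebra_simps)
    then show ?thesis using s by (simp add: d)
  qed
  show ?A
  proof (rule tr)
    show "((\<lambda>t. (1 - t / (y + z)) * (y * z) / Q t) has_real_derivative - d * (y + z)) (at 0)"
      unfolding e[symmetric] using yz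
      by (auto intro!: derivative_eq_intros dQ simp: Q0(2)) (simp add: Q0(1) power2_eq_square)
  qed (use p in \<open>auto simp: SQ\<close>)
  have B: "((\<lambda>t. (x + t) / Q t * r) has_real_derivative d * r) (at 0)" for r
    unfolding e'[symmetric]
    by (auto intro!: derivative_eq_intros dQ simp: Q0(2)) (simp add: Q0(1) power2_eq_square algebra_simps)
  show ?B by (rule tr[OF B]) (use p in \<open>auto simp: SQ w\<close>)
  show ?C by (rule tr[OF B]) (use p in \<open>auto simp: SQ w\<close>)
qed

lemma RD_velocity:
  fixes c :: "real^3" and i :: 3
  assumes "c \<in> RNS_interior"
  shows "((\<lambda>t. RD (c + t *\<^sub>R (\<chi> k. if k = i then 1 else - c $ k / (\<Sum>l\<in>-{i}. c $ l))))
           has_vector_derivative vertex_shift c i) (at 0)"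
proof -
  have others: "-{1::3} = {2, 3}" "-{2::3} = {1, 3}" "-{3::3} = {1, 2}"
    "-{1::3, 2} = {3}" "-{2::3, 1} = {3}" "-{1::3, 3} = {2}"
    "-{3::3, 1} = {2}" "-{2::3, 3} = {1}" "-{3::3, 2} = {1}"
    using exhaust_3 by auto
  have p: "0 < c $ 1" "0 < c $ 2" "0 < c $ 3" and s: "c $ 1 + c $ 2 + c $ 3 = 1"
    using assms by (auto simp: RNS_interior_def RNS_def sum_3)
  note V1 = RD_velocity_real[OF p s]
  note V2 = RD_velocity_real[OF p(2,1,3)]
  note V3 = RD_velocity_real[OF p(3,1,2)]
  define f where "f = (\<lambda>t. RD (c + t *\<^sub>R
    (\<chi> k. if k = i then 1 else - c $ k / (\<Sum>l\<in>-{i}. c $ l))))"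
  have "((\<lambda>t. f t $ k) has_real_derivative vertex_shift c i $ k) (at 0)" for k
    using exhaust_3[of i] exhaust_3[of k] V1 V2 V3 s
    by (auto simp: f_def RD_def normalized_def vertex_shift_def shift_rate_def Let_def
        others sum_3 ac_simps)
  then have "(f has_vector_derivative vertex_shift c i) (at 0)"
    unfolding has_vector_derivative_def has_field_derivative_def
    by (subst has_derivative_componentwise_within)
       (auto simp: Basis_vec_def inner_axis mult_commute_abs)
  then show ?thesis unfolding f_def .
qed

text \<open>Distinct adjacent vertices lie on a line through exactly one vertex of the simplex,
  so the definite descriptions below are well defined.\<close>

definition deriv_towards :: "real^'m^3 \<Rightarrow> real^3 \<Rightarrow> real^3 \<Rightarrow> real" where
  "deriv_towards a v w =
     (if \<exists>i. w \<in> closed_segment v (player_vertex i)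
      then delta_g a v (vertex_shift v (THE i. w \<in> closed_segment v (player_vertex i)))
      else delta_g a v (- vertex_shift v (THE i. v \<in> closed_segment w (player_vertex i))))"

definition declared_optimal :: "real^'m^3 \<Rightarrow> real^3 \<Rightarrow> bool" where
  "declared_optimal a v \<longleftrightarrow>
     v \<in> graph_verts a \<and> (\<forall>w. graph_adj a v w \<longrightarrow> 0 \<le> deriv_towards a v w)"

text \<open>Ties for the lowest derivative are left open, so \<open>alg_step a\<close> is a relation.\<close>

definition alg_step :: "real^'m^3 \<Rightarrow> real^3 \<Rightarrow> real^3 \<Rightarrow> bool" where
  "alg_step a v w \<longleftrightarrow> (\<exists>u. graph_adj a v u \<and> deriv_towards a v u < 0) \<and> graph_adj a v w \<and>
     (\<forall>u. graph_adj a v u \<longrightarrow> deriv_towards a v w \<le> deriv_towards a v u)"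

end

theory Submission
  imports Defs
begin

text \<open>Comparing the ratios \<open>x $ k / c $ k\<close> of a good \<open>x\<close> at a point \<open>c\<close> makes the problem
  combinatorial: the players with the largest ratio (the leaders) decide which part or disputing
  segment of \<open>c\<close> contains the good, and the value of \<open>g\<close> at \<open>RD c\<close> is proportional to the sum
  of the largest ratios.
  If a good changes its leader along a supporting segment, then it does so at a vertex of the graph.
  Hence \<open>g\<close> is linear in the hyperplane coefficients along every arc and strictly decreases in
  each step, and the algorithm stops because there are only finitely many vertices.
  At a final vertex, write a shift as \<open>s $ k = \<sigma> k / c $ k\<close>. Then \<open>\<Delta>g\<close> becomes a weighted sum of
  maxima of the \<open>\<sigma> k\<close> over sets of leaders, which is linear on each cone
  \<open>\<sigma> x \<ge> \<sigma> y \<ge> \<sigma> z\<close>. So nonnegativity in all directions follows from nonnegativity in the six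
  directions towards and away from the players' vertices. Six nonnegative derivatives
  imply, by separation, that the face meets the egalitarian ray.\<close>

section \<open>Leaders\<close>

text \<open>The weights \<open>RD c\<close> are proportional to \<open>1 / c $ k\<close>, so
  \<open>a $ k $ j / c $ k\<close> is, up to a common factor, the weighted value of good
  \<open>j\<close> to player \<open>k\<close>. This is the origin of the ratios: giving every good
  only to its leaders maximises the weighted value at \<open>RD c\<close>. Leaders do not change
  when either argument is rescaled, so the raw columns of \<open>a\<close> can replace the plotted
  points, and positions need to be normalised only at the end. Three obstacles shape the proof.
  Vertices of the graph are crossings of s-independent goods, while linearity along an arc requires
  control of every good; hence a change of leader has to be traced back to an s-independent pair.
  The stopping test only sees directions that carry an arc, while the separation argument needs all
  six; the others follow by counting goods. Finally, an arc may lead away from a player's vertex; it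
  is then described from its far end, so that one computation serves both orientations.\<close>

definition leaders :: "real^3 \<Rightarrow> real^3 \<Rightarrow> 3 set" where
  "leaders c x = {i. \<forall>k. x $ k / c $ k \<le> x $ i / c $ i}"

definition top_ratio :: "real^3 \<Rightarrow> real^3 \<Rightarrow> real" where
  "top_ratio c x = Max (range (\<lambda>k. x $ k / c $ k))"

section \<open>Case distinctions over three players\<close>

lemma obtain_other_players:
  fixes i :: 3
  obtains k l where "k \<noteq> i" "l \<noteq> i" "k \<noteq> l"
proof -
  have "card (-{i}) = 2" by (simp add: Compl_eq_Diff_UNIV)
  then obtain k l where "-{i} = {k, l}" "k \<noteq> l" by (meson card_2_iff)
  then show thesis by (intro that[of k l]) blast+
qed

lemma UNIV_eq_distinct:
  fixes i k l :: 3
  assumes "i \<noteq> k" "i \<noteq> l" "k \<noteq> l"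
  shows "UNIV = {i, k, l}"
proof -
  have "card {i, k, l} = CARD(3)" using assms by simp
  then have "{i, k, l} = UNIV" by (intro card_subset_eq) auto
  then show ?thesis ..
qed

lemma Compl_singleton_subset_iff: "-{i} \<subseteq> L \<longleftrightarrow> L = UNIV \<or> L = -{i}"
  by (cases "i \<in> L") auto

lemma singleton_neq_UNIV: "{i::3} \<noteq> UNIV" and Compl_singleton_neq: "-{i::3} \<noteq> {n}"
proof -
  have "card {i} \<noteq> CARD(3)" "card (-{i}) \<noteq> card {n}"
    by (simp_all add: Compl_eq_Diff_UNIV)
  then show "{i} \<noteq> UNIV" "-{i} \<noteq> {n}" by metis+
qed

lemma all_players_iff:
  fixes i k l :: 3
  assumes "k \<noteq> i" "l \<noteq> i" "k \<noteq> l"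
  shows "(\<forall>n. P n) \<longleftrightarrow> P i \<and> P k \<and> P l"
proof -
  have "(\<forall>n. P n) \<longleftrightarrow> (\<forall>n\<in>{i, k, l}. P n)"
    using UNIV_eq_distinct[of i k l] assms by (metis UNIV_I)
  then show ?thesis by simp
qed

lemma sum_distinct_players:
  fixes f :: "3 \<Rightarrow> real"
  assumes "i \<noteq> k" "i \<noteq> l" "k \<noteq> l"
  shows "sum f UNIV = f i + f k + f l"
  unfolding UNIV_eq_distinct[OF assms] using assms by simp

lemma top_ratio_ge: "x $ i / c $ i \<le> top_ratio c x"
  unfolding top_ratio_def by (rule Max_ge) auto

lemma top_ratio_leader: "i \<in> leaders c x \<Longrightarrow> top_ratio c x = x $ i / c $ i"
  unfolding top_ratio_def leaders_def by (rule Max_eqI) auto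

lemma leaders_nonempty: "leaders c x \<noteq> {}"
proof -
  have "top_ratio c x \<in> range (\<lambda>k. x $ k / c $ k)" unfolding top_ratio_def by (rule Max_in) auto
  then obtain i where i: "top_ratio c x = x $ i / c $ i" by (elim rangeE)
  have "x $ k / c $ k \<le> x $ i / c $ i" for k using top_ratio_ge[of x k c] unfolding i .
  then have "i \<in> leaders c x" unfolding leaders_def by blast
  then show ?thesis by blast
qed

lemma leaders_eq_top_ratio: "leaders c x = {i. x $ i / c $ i = top_ratio c x}"
proof (intro set_eqI iffI)
  fix i assume "i \<in> {i. x $ i / c $ i = top_ratio c x}"
  then show "i \<in> leaders c x" using top_ratio_ge[of x _ c] by (simp add: leaders_def)
qed (simp add: top_ratio_leader)

lemma leaders_cases:
  obtains "leaders c x = UNIV" | i where "leaders c x = -{i}" | i where "leaders c x = {i}"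
proof -
  obtain i where i: "i \<in> leaders c x" using leaders_nonempty by blast
  obtain k l where kl: "k \<noteq> i" "l \<noteq> i" "k \<noteq> l" by (rule obtain_other_players)
  note all = all_players_iff[OF kl]
  have "leaders c x = UNIV \<or> leaders c x = -{k} \<or> leaders c x = -{l} \<or> leaders c x = {i}"
    unfolding set_eq_iff all using i kl by auto
  then show thesis using that by blast
qed

lemma RNS_interior_pos: "c \<in> RNS_interior \<Longrightarrow> 0 < c $ i"
  and RNS_interior_RNS: "c \<in> RNS_interior \<Longrightarrow> c \<in> RNS"
  and RNS_nonneg: "x \<in> RNS \<Longrightarrow> 0 \<le> x $ i"
  and RNS_sum: "x \<in> RNS \<Longrightarrow> sum (($) x) UNIV = 1"
  by (auto simp: RNS_interior_def RNS_def)

text \<open>Equal ratios make \<open>x\<close> a multiple of \<open>c\<close>, and both have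
  coordinate sum 1. This is the case of a good located at \<open>c\<close>.\<close>

lemma leaders_UNIV_iff:
  assumes "c \<in> RNS_interior" "x \<in> RNS"
  shows "leaders c x = UNIV \<longleftrightarrow> x = c"
proof
  assume "leaders c x = UNIV"
  then have "x $ k = top_ratio c x * c $ k" for k
    using top_ratio_leader[of k c x] RNS_interior_pos[OF assms(1), of k] by simp
  then have *: "(\<lambda>k. x $ k) = (\<lambda>k. top_ratio c x * c $ k)" by blast
  then have "sum (($) x) UNIV = top_ratio c x * sum (($) c) UNIV"
    by (simp add: sum_distrib_left)
  then have "top_ratio c x = 1" using assms RNS_sum[of x] RNS_sum[of c] RNS_interior_RNS by simp
  then show "x = c" using * by (simp add: vec_eq_iff fun_eq_iff)
next
  assume "x = c"
  then show "leaders c x = UNIV"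
    using RNS_interior_pos[OF assms(1)] by (auto simp: leaders_def less_imp_neq[symmetric])
qed

section \<open>Supporting segments, disputing segments and parts in terms of leaders\<close>

lemma convex_RNS: "convex RNS"
  unfolding RNS_def convex_def
  by (auto simp: sum.distrib sum_distrib_left[symmetric])

lemma player_vertex_RNS: "player_vertex i \<in> RNS"
proof -
  obtain k l where kl: "k \<noteq> i" "l \<noteq> i" "k \<noteq> l" by (rule obtain_other_players)
  then show ?thesis
    unfolding RNS_def using sum_distinct_players[of i k l "($) (axis i 1)"]
    by (auto simp: axis_def)
qed

text \<open>Walking from \<open>x\<close> to the vertex of player \<open>i\<close> multiplies the
  other two coordinates by a common factor \<open>1 - t\<close> and makes the \<open>i\<close>-th
  one relatively larger. So the ratios of the other players stay tied, and that of \<open>i\<close>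
  cannot exceed them.\<close>

lemma mem_segment_to_vertex_iff:
  assumes c: "c \<in> RNS_interior" and x: "x \<in> RNS"
  shows "c \<in> closed_segment x (player_vertex i) \<longleftrightarrow> -{i} \<subseteq> leaders c x"
proof -
  obtain k l where kl: "k \<noteq> i" "l \<noteq> i" "k \<noteq> l" by (rule obtain_other_players)
  note all = all_players_iff[OF kl]
  note pos = RNS_interior_pos[OF c]
  have sums: "c $ i + c $ k + c $ l = 1" "x $ i + x $ k + x $ l = 1"
    using RNS_sum[OF RNS_interior_RNS[OF c]] RNS_sum[OF x] kl
    by (simp_all add: sum_distinct_players[of i k l])
  show ?thesis
  proof
    assume "c \<in> closed_segment x (player_vertex i)"
    then obtain t where t: "0 \<le> t" "t \<le> 1" "c = (1 - t) *\<^sub>R x + t *\<^sub>R axis i 1"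
      by (auto simp: in_segment)
    have ck: "c $ k = (1 - t) * x $ k" "c $ l = (1 - t) * x $ l" "c $ i = (1 - t) * x $ i + t"
      using t kl by (simp_all add: axis_def)
    have t1: "1 - t > 0" using ck(1) pos[of k] t by (cases "t = 1") auto
    have "x $ k > 0" "x $ l > 0" using ck pos[of k] pos[of l] t1 by (simp_all add: zero_less_mult_iff)
    then have q: "x $ k / c $ k = 1 / (1 - t)" "x $ l / c $ l = 1 / (1 - t)"
      using t1 by (simp_all add: ck)
    have "x $ i * (1 - t) \<le> c $ i" using ck t by (simp add: mult.commute)
    then have "x $ i / c $ i \<le> 1 / (1 - t)" using pos[of i] t1 by (simp add: field_simps)
    then show "-{i} \<subseteq> leaders c x"
      using kl q unfolding subset_iff leaders_def all by auto
  next
    assume sub: "-{i} \<subseteq> leaders c x"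
    \<comment> \<open>The tied ratio must be \<open>1 / (1 - t)\<close>. Comparing coordinate sums
      gives \<open>r \<ge> 1\<close>, so \<open>1 - 1 / r\<close> is an admissible parameter of the
      segment.\<close>
    define r where "r = top_ratio c x"
    have "x $ k / c $ k = r" "x $ l / c $ l = r" "x $ i / c $ i \<le> r"
      using sub kl top_ratio_leader[of k c x] top_ratio_leader[of l c x] top_ratio_ge[of x i c]
      by (auto simp: r_def)
    then have xk: "x $ k = r * c $ k" "x $ l = r * c $ l" "x $ i \<le> r * c $ i"
      using pos[of i] pos[of k] pos[of l] by (auto simp: field_simps)
    have "1 \<le> r * c $ i + r * c $ k + r * c $ l" using xk sums by linarith
    also have "\<dots> = r * (c $ i + c $ k + c $ l)" by (simp only: distrib_left)
    finally have r: "r \<ge> 1" using sums by simp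
    have rk: "c $ k = x $ k / r" "c $ l = x $ l / r" using xk r by auto
    have "c $ i = 1 - (x $ k + x $ l) / r" using sums rk by (simp add: add_divide_distrib)
    also have "\<dots> = x $ i / r + (1 - 1 / r)"
    proof -
      have "x $ k + x $ l = 1 - x $ i" using sums by simp
      then show ?thesis by (simp add: diff_divide_distrib)
    qed
    finally have ri: "c $ i = x $ i / r + (1 - 1 / r)" .
    have "c = (1 - (1 - 1 / r)) *\<^sub>R x + (1 - 1 / r) *\<^sub>R axis i 1"
      unfolding vec_eq_iff all using rk ri kl by (auto simp: axis_def)
    then show "c \<in> closed_segment x (player_vertex i)" using r unfolding in_segment
      by (intro exI[of _ "1 - 1/r"]) auto
  qed
qed

text \<open>A disputing segment continues the line from the vertex of player \<open>i\<close> beyond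
  \<open>c\<close>, so its points are those that see \<open>c\<close> on their way to this vertex;
  excluding \<open>c\<close> itself excludes the tie of all three players.\<close>

lemma disputing_segment_iff:
  assumes c: "c \<in> RNS_interior"
  shows "x \<in> disputing_segment c i \<longleftrightarrow> x \<in> RNS \<and> leaders c x = -{i}"
proof -
  obtain k l where kl: "k \<noteq> i" "l \<noteq> i" "k \<noteq> l" by (rule obtain_other_players)
  note all = all_players_iff[OF kl]
  note pos = RNS_interior_pos[OF c]
  have sumc: "c $ i + c $ k + c $ l = 1"
    using RNS_sum[OF RNS_interior_RNS[OF c]] kl by (simp add: sum_distinct_players[of i k l])
  show ?thesis
  proof
    assume "x \<in> disputing_segment c i"
    then obtain p where p: "p \<in> RNS" "p $ i = 0" "c \<in> closed_segment (player_vertex i) p"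
      "x \<in> closed_segment c p" "x \<noteq> c" by (auto simp: disputing_segment_def)
    have x: "x \<in> RNS"
      using p convex_RNS RNS_interior_RNS[OF c] by (meson closed_segment_subset subsetD)
    have "c \<in> closed_segment x (player_vertex i)"
      using between_trans_2[of p "player_vertex i" c x] p
      by (simp add: between_mem_segment closed_segment_commute)
    then have "-{i} \<subseteq> leaders c x" using mem_segment_to_vertex_iff[OF c x] by simp
    moreover have "leaders c x \<noteq> UNIV" using leaders_UNIV_iff[OF c x] p by simp
    ultimately show "x \<in> RNS \<and> leaders c x = -{i}" using x by (simp add: Compl_singleton_subset_iff)
  next
    assume *: "x \<in> RNS \<and> leaders c x = -{i}"
    then have x: "x \<in> RNS" and L: "leaders c x = -{i}" by auto
    have sumx: "x $ i + x $ k + x $ l = 1"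
      using RNS_sum[OF x] kl by (simp add: sum_distinct_players[of i k l])
    have "leaders c x \<noteq> UNIV" using L by auto
    then have xc: "x \<noteq> c" using leaders_UNIV_iff[OF c x] by simp
    define r where "r = top_ratio c x"
    have "x $ k / c $ k = r" "x $ l / c $ l = r" "x $ i / c $ i \<le> r"
      using L kl top_ratio_leader[of k c x] top_ratio_leader[of l c x] top_ratio_ge[of x i c]
      by (auto simp: r_def)
    then have xk: "x $ k = r * c $ k" "x $ l = r * c $ l" "x $ i \<le> r * c $ i"
      using pos[of i] pos[of k] pos[of l] by (auto simp: field_simps)
    define d where "d = 1 - c $ i"
    have d: "d > 0" "c $ i + d = 1" "c $ k + c $ l = d" using pos[of k] pos[of l] sumc by (simp_all add: d_def)
    have rd: "r * d = 1 - x $ i" using xk sumx by (simp add: d(3)[symmetric] algebra_simps)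
    have "x $ i / c $ i * d \<le> r * d"
      using d by (intro mult_right_mono) (auto simp: r_def top_ratio_ge)
    moreover have "x $ i / c $ i * c $ i = x $ i" using pos[of i] by simp
    ultimately have "x $ i / c $ i * c $ i + x $ i / c $ i * d \<le> 1" using rd by linarith
    then have "x $ i / c $ i * (c $ i + d) \<le> 1" by (simp only: distrib_left)
    then have xi: "x $ i / c $ i \<le> 1" using d by simp
    \<comment> \<open>The end of the disputing segment is the projection of \<open>c\<close> from
      the vertex of player \<open>i\<close> onto the opposite side: the \<open>i\<close>-th
      coordinate is dropped and the rest is rescaled to sum 1.\<close>
    define p where "p = (\<chi> n. if n = i then 0 else c $ n / d)"
    have "0 \<le> p $ n" for n using d(1) pos[of n] by (simp add: p_def)
    moreover have "sum (($) p) UNIV = 1"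
      using kl d by (simp add: sum_distinct_players[of i k l] p_def add_divide_distrib[symmetric])
    ultimately have "p \<in> RNS" unfolding RNS_def by simp
    moreover have "p $ i = 0" by (simp add: p_def)
    moreover have "c \<in> closed_segment (player_vertex i) p"
    proof -
      have "c = (1 - d) *\<^sub>R player_vertex i + d *\<^sub>R p"
        using d by (auto simp: vec_eq_iff p_def axis_def)
      then show ?thesis using d pos[of i] unfolding in_segment by (intro exI[of _ d]) auto
    qed
    moreover have "x \<in> closed_segment c p"
    proof -
      \<comment> \<open>Since \<open>p $ i = 0\<close>, the \<open>i\<close>-th coordinate alone
        determines the position of \<open>x\<close> between \<open>c\<close> and
        \<open>p\<close>.\<close>
      define t where "t = 1 - x $ i / c $ i"
      have "x $ n = (1 - t) * c $ n + t * p $ n" for n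
      proof (cases "n = i")
        case True
        then show ?thesis using pos[of i] by (simp add: t_def p_def)
      next
        case False
        have "\<forall>n. n \<noteq> i \<longrightarrow> x $ n = r * c $ n" unfolding all using xk by simp
        then have "x $ n = r * c $ n" using False by blast
        also have "r = (1 - t) + t / d"
        proof -
          have "t * c $ i = c $ i - x $ i" using pos[of i] by (simp add: t_def left_diff_distrib)
          then have "t * (1 - d) = 1 - d - x $ i" by (simp add: d_def)
          then have "((1 - t) + t / d) * d = r * d" using d rd by (simp add: algebra_simps)
          then show ?thesis using d by simp
        qed
        finally show ?thesis using False by (simp add: p_def algebra_simps)
      qed
      then have "x = (1 - t) *\<^sub>R c + t *\<^sub>R p" by (simp add: vec_eq_iff)
      moreover have "0 \<le> t" "t \<le> 1" using xi RNS_nonneg[OF x, of i] pos[of i] by (auto simp: t_def)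
      ultimately show ?thesis unfolding in_segment by blast
    qed
    ultimately show "x \<in> disputing_segment c i" using xc unfolding disputing_segment_def by blast
  qed
qed

lemma leaders_singleton_iff: "leaders c x = {i} \<longleftrightarrow> (\<forall>k. k \<noteq> i \<longrightarrow> x $ k / c $ k < x $ i / c $ i)"
proof
  assume L: "leaders c x = {i}"
  show "\<forall>k. k \<noteq> i \<longrightarrow> x $ k / c $ k < x $ i / c $ i"
  proof (intro allI impI)
    fix k assume "k \<noteq> i"
    then have "x $ k / c $ k \<noteq> top_ratio c x" using L unfolding leaders_eq_top_ratio by blast
    then show "x $ k / c $ k < x $ i / c $ i"
      using top_ratio_ge[of x k c] top_ratio_leader[of i c x] L by simp
  qed
next
  assume *: "\<forall>k. k \<noteq> i \<longrightarrow> x $ k / c $ k < x $ i / c $ i"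
  have "x $ k / c $ k \<le> x $ i / c $ i" for k
    using *[rule_format, of k] by (cases "k = i") auto
  then have "i \<in> leaders c x" unfolding leaders_def by blast
  moreover have "k \<notin> leaders c x" if "k \<noteq> i" for k
    using * that unfolding leaders_def by (auto simp: not_le)
  ultimately show "leaders c x = {i}" by blast
qed

text \<open>The regions \<open>U k\<close> with sole leader \<open>k\<close> are open, pairwise
  disjoint and cover the simplex without \<open>c\<close> and its disputing segments. Each is an
  intersection of half-spaces, so its trace on the simplex is connected; hence these traces are
  exactly the components.\<close>

lemma PAR_part_iff:
  assumes c: "c \<in> RNS_interior"
  shows "x \<in> PAR_part c i \<longleftrightarrow> x \<in> RNS \<and> leaders c x = {i}"
proof -
  note pos = RNS_interior_pos[OF c]
  define R where "R = RNS - insert c (\<Union>k. disputing_segment c k)"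
  define U where "U k = {x. \<forall>n. n \<noteq> k \<longrightarrow> x $ n / c $ n < x $ k / c $ k}" for k
  have U: "U k = {x. leaders c x = {k}}" for k by (simp add: U_def leaders_singleton_iff)
  have openU: "open (U k)" for k
  proof -
    have "U k = (\<Inter>n\<in>-{k}. {x. x $ n / c $ n < x $ k / c $ k})" by (auto simp: U_def)
    also have "open \<dots>"
      using pos by (intro open_INT) (auto intro!: open_Collect_less continuous_intros simp: less_imp_neq[symmetric])
    finally show ?thesis .
  qed
  have R: "R = RNS \<inter> (\<Union>k. U k)"
  proof -
    have "x \<in> R \<longleftrightarrow> (\<exists>k. leaders c x = {k})" if x: "x \<in> RNS" for x
    proof -
      have "x \<in> R \<longleftrightarrow> leaders c x \<noteq> UNIV \<and> (\<forall>k. leaders c x \<noteq> -{k})"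
        using disputing_segment_iff[OF c] leaders_UNIV_iff[OF c x] x by (simp add: R_def)
      also have "\<dots> \<longleftrightarrow> (\<exists>k. leaders c x = {k})"
        by (cases rule: leaders_cases[of c x])
          (simp_all add: singleton_neq_UNIV singleton_neq_UNIV[symmetric]
             Compl_singleton_neq Compl_singleton_neq[symmetric])
      finally show ?thesis .
    qed
    moreover have "R \<subseteq> RNS" by (auto simp: R_def)
    ultimately show ?thesis unfolding U by blast
  qed
  have ei: "player_vertex i \<in> RNS \<inter> U i"
    using player_vertex_RNS pos by (auto simp: U_def axis_def)
  have "convex (U i)"
  proof -
    have "U i = (\<Inter>n\<in>-{i}. {x. x $ n / c $ n < x $ i / c $ i})" by (auto simp: U_def)
    also have "convex \<dots>"
    proof (intro convex_INT)
      fix n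
      have "{x. x $ n / c $ n < x $ i / c $ i} = {x. (axis n (1 / c $ n) - axis i (1 / c $ i)) \<bullet> x < 0}"
        by (simp add: inner_diff_left inner_axis')
      then show "convex {x. x $ n / c $ n < x $ i / c $ i}" by (simp add: convex_halfspace_lt)
    qed
    finally show ?thesis .
  qed
  then have "connected (RNS \<inter> U i)" using convex_RNS by (intro convex_connected convex_Int)
  then have 1: "RNS \<inter> U i \<subseteq> PAR_part c i"
    unfolding PAR_part_def R_def[symmetric] using ei
    by (intro connected_component_maximal) (auto simp: R)
  have "PAR_part c i \<subseteq> R" unfolding PAR_part_def R_def[symmetric] by (rule connected_component_subset)
  moreover have "(\<Union>k\<in>-{i}. U k) \<inter> PAR_part c i = {}"
  proof -
    have "U i \<inter> PAR_part c i = {} \<or> (\<Union>k\<in>-{i}. U k) \<inter> PAR_part c i = {}"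
    proof (rule connectedD)
      show "connected (PAR_part c i)" by (simp add: PAR_part_def)
      show "U i \<inter> (\<Union>k\<in>-{i}. U k) \<inter> PAR_part c i = {}" by (auto simp: U)
      show "PAR_part c i \<subseteq> U i \<union> (\<Union>k\<in>-{i}. U k)"
      proof
        fix x assume "x \<in> PAR_part c i"
        then have "x \<in> (\<Union>k. U k)" using \<open>PAR_part c i \<subseteq> R\<close> unfolding R by (metis IntD2 subsetD)
        then obtain k where "x \<in> U k" by (elim UN_E)
        then show "x \<in> U i \<union> (\<Union>k\<in>-{i}. U k)" by (cases "k = i") auto
      qed
    qed (auto intro: openU)
    moreover have "player_vertex i \<in> U i \<inter> PAR_part c i" using 1 ei by (meson IntD2 IntI subsetD)
    ultimately show ?thesis by (metis empty_iff)
  qed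
  ultimately have "PAR_part c i \<subseteq> RNS \<inter> U i" unfolding R by fastforce
  then have "PAR_part c i = RNS \<inter> U i" using 1 by (rule subset_antisym)
  then show ?thesis by (auto simp: U)
qed

section \<open>Directional derivatives\<close>

text \<open>Homogeneity in both arguments permits working with columns of \<open>a\<close> instead
  of plotted goods and with unnormalised positions.\<close>

lemma leaders_scaleR_right: "0 < r \<Longrightarrow> leaders c (r *\<^sub>R x) = leaders c x"
  by (simp add: leaders_def mult_le_cancel_left_pos times_divide_eq_right[symmetric] del: times_divide_eq_right)

lemma leaders_scaleR_left:
  assumes "0 < r"
  shows "leaders (r *\<^sub>R c) x = leaders c x"
proof -
  have "x $ k / (r * c $ k) = (1 / r) * (x $ k / c $ k)" for k by simp
  then show ?thesis using assms
    by (simp add: leaders_def mult_le_cancel_left_pos del: times_divide_eq_right divide_divide_eq_left mult_1 times_divide_eq_left)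
qed

lemma normalized_eq_scaleR: "normalized x = (1 / sum (($) x) UNIV) *\<^sub>R x"
  by (simp add: normalized_def vec_eq_iff)

lemma sum_pos_vec: "(\<And>i. 0 < x $ i) \<Longrightarrow> 0 < sum (($) (x :: real^3)) UNIV"
  by (intro sum_pos) auto

lemma normalized_in_RNS_interior:
  assumes "\<And>i. 0 < x $ i"
  shows "normalized x \<in> RNS_interior"
  using sum_pos_vec[of x] assms
  by (auto simp: RNS_interior_def RNS_def normalized_def sum_divide_distrib[symmetric] less_imp_le)

text \<open>With \<open>pair_sum\<close>, the second elementary symmetric polynomial, this gives a
  form of the weights without nested fractions: for positive \<open>c\<close>,
  \<open>RD c $ i\<close> is \<open>pair_prod c i / pair_sum c\<close>. The square in
  \<open>shift_rate\<close> is that of \<open>pair_sum\<close>.\<close>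

definition pair_prod :: "real^3 \<Rightarrow> 3 \<Rightarrow> real" where
  "pair_prod c i = (\<Prod>k\<in>-{i}. c $ k)"

definition pair_sum :: "real^3 \<Rightarrow> real" where
  "pair_sum c = (\<Sum>i\<in>UNIV. pair_prod c i)"

text \<open>The value of \<open>g\<close> for the unnormalised weights \<open>1 / c $ k\<close>.
  Columns of \<open>a\<close> are used, not plotted points, because the size of a good counts
  here.\<close>

definition total_ratio :: "real^'m^3 \<Rightarrow> real^3 \<Rightarrow> real" where
  "total_ratio a c = (\<Sum>j\<in>UNIV. top_ratio c (column j a))"

text \<open>The part of \<open>total_ratio\<close> that player \<open>i\<close> keeps when the
  weight of \<open>i\<close> drops slightly in comparison with the others;
  \<open>shared_ratio\<close> is the part that \<open>i\<close> obtains when it rises.\<close>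

definition sole_ratio :: "real^'m^3 \<Rightarrow> real^3 \<Rightarrow> 3 \<Rightarrow> real" where
  "sole_ratio a c i = (\<Sum>j | leaders c (column j a) = {i}. top_ratio c (column j a))"

definition shared_ratio :: "real^'m^3 \<Rightarrow> real^3 \<Rightarrow> 3 \<Rightarrow> real" where
  "shared_ratio a c i = (\<Sum>j | i \<in> leaders c (column j a). top_ratio c (column j a))"

lemma compl_player_eq:
  fixes i k l :: 3
  assumes "k \<noteq> i" "l \<noteq> i" "k \<noteq> l"
  shows "-{i} = {k, l}"
  unfolding set_eq_iff all_players_iff[OF assms] using assms by auto

lemma pair_prod_eq:
  assumes "k \<noteq> i" "l \<noteq> i" "k \<noteq> l"
  shows "pair_prod c i = c $ k * c $ l"
  unfolding pair_prod_def compl_player_eq[OF assms] using assms by simp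

lemma pair_sum_eq:
  assumes "k \<noteq> i" "l \<noteq> i" "k \<noteq> l"
  shows "pair_sum c = c $ k * c $ l + c $ i * (c $ k + c $ l)"
  unfolding pair_sum_def using assms
  by (simp add: sum_distinct_players[of i k l] pair_prod_eq[of k i l] pair_prod_eq[of i k l] pair_prod_eq[of i l k]
      algebra_simps)

text \<open>The shift keeps the proportion of the other two weights, so after multiplication by
  \<open>c $ k\<close> it takes only two values: one common to the other players and a different one
  for \<open>i\<close>. This makes the maxima in \<open>delta_g\<close> a matter of whether
  \<open>i\<close> leads.\<close>

lemma vertex_shift_mult:
  shows "c $ k * vertex_shift c i $ k =
    shift_rate c i * (if k = i then pair_prod c i - pair_sum c else pair_prod c i)"
proof (cases "k = i")
  case True
  obtain k' l where kl: "k' \<noteq> i" "l \<noteq> i" "k' \<noteq> l" by (rule obtain_other_players)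
  show ?thesis unfolding True vertex_shift_def
    by (simp add: pair_sum_eq[OF kl] pair_prod_eq[OF kl] compl_player_eq[OF kl] kl algebra_simps)
next
  case False
  obtain l where l: "l \<noteq> i" "k \<noteq> l"
  proof -
    obtain p q where pq: "p \<noteq> i" "q \<noteq> i" "p \<noteq> q" by (rule obtain_other_players)
    show thesis using that[of p] that[of q] pq by (cases "k = p") auto
  qed
  have "-{i, k} = {l}" using compl_player_eq[OF False l] l False by auto
  then show ?thesis using False l
    by (simp add: vertex_shift_def pair_prod_eq[OF False l])
qed

lemma shift_rate_pos:
  assumes "c \<in> RNS_interior"
  shows "0 < shift_rate c i"
proof -
  note pos = RNS_interior_pos[OF assms]
  obtain k l where kl: "k \<noteq> i" "l \<noteq> i" "k \<noteq> l" by (rule obtain_other_players)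
  have "shift_rate c i = c $ k * c $ l / ((c $ k + c $ l) * (c $ k * c $ l + c $ i * (c $ k + c $ l))\<^sup>2)"
    by (simp add: shift_rate_def compl_player_eq[OF kl] kl Let_def)
  also have "0 < \<dots>" by (intro divide_pos_pos mult_pos_pos zero_less_power add_pos_pos pos)
  finally show ?thesis .
qed

lemma Max_mult_right:
  assumes "finite S" "S \<noteq> {}" "0 \<le> (m::real)"
  shows "Max ((\<lambda>k. f k * m) ` S) = Max (f ` S) * m"
proof -
  have "mono (\<lambda>x. x * m)" using assms by (intro monoI mult_right_mono)
  from mono_Max_commute[OF this, of "f ` S"] show ?thesis using assms by (simp add: image_image)
qed

locale positive_values =
  fixes a :: "real^'m^3"
  assumes value_pos: "\<And>i j. a $ i $ j > 0"
begin

lemma column_pos: "0 < column j a $ i"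
  using value_pos by (simp add: column_def)

lemma good_point_eq: "good_point a j = normalized (column j a)"
  by (simp add: good_point_def column_def)

lemma good_point_interior: "good_point a j \<in> RNS_interior"
  unfolding good_point_eq by (rule normalized_in_RNS_interior) (rule column_pos)

lemma leaders_good_point [simp]: "leaders c (good_point a j) = leaders c (column j a)"
  unfolding good_point_eq normalized_eq_scaleR
  by (intro leaders_scaleR_right) (simp add: sum_pos_vec column_pos)

lemma top_ratio_pos:
  assumes "c \<in> RNS_interior"
  shows "0 < top_ratio c (column j a)"
  using top_ratio_ge[of "column j a" 1 c] column_pos[of j 1] RNS_interior_pos[OF assms, of 1]
  by (meson divide_pos_pos less_le_trans)

lemma value_leader:
  assumes "c \<in> RNS_interior" "i \<in> leaders c (column j a)"
  shows "a $ i $ j = c $ i * top_ratio c (column j a)"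
  using top_ratio_leader[OF assms(2)] RNS_interior_pos[OF assms(1), of i] by (simp add: column_def)

text \<open>A good is disputed exactly when it has several leaders, and then its leaders are the
  disputing players; an undisputed good contributes a maximum over one player. All leaders of a good
  have values \<open>c $ i\<close> times the same top ratio, which can therefore be taken out of the
  maximum.\<close>

lemma delta_g_eq:
  assumes c: "c \<in> RNS_interior"
  shows "delta_g a c s =
    (\<Sum>j\<in>UNIV. Max ((\<lambda>k. c $ k * s $ k) ` leaders c (column j a)) * top_ratio c (column j a))"
proof -
  let ?L = "\<lambda>j. leaders c (column j a)"
  define M where "M j = Max ((\<lambda>k. s $ k * a $ k $ j) ` ?L j)" for j
  have RNS: "good_point a j \<in> RNS" for j using RNS_interior_RNS[OF good_point_interior] .
  have und: "undisputed_value a c i = (\<Sum>j | ?L j = {i}. a $ i $ j)" for i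
    by (simp add: undisputed_value_def PAR_part_iff[OF c] RNS)
  have eqc: "good_point a j = c \<longleftrightarrow> ?L j = UNIV" for j
    using leaders_UNIV_iff[OF c RNS[of j]] by simp
  have dis: "disputed_goods a c = {j. ?L j = UNIV \<or> (\<exists>i. ?L j = -{i})}"
    by (simp add: disputed_goods_def disputing_segment_iff[OF c] RNS eqc)
  have dpl: "disputing_players a c j = ?L j" if jd: "j \<in> disputed_goods a c" for j
  proof (cases "?L j = UNIV")
    case True
    then show ?thesis by (simp add: disputing_players_def eqc)
  next
    case False
    moreover have "?L j = UNIV \<or> (\<exists>i. ?L j = -{i})" using jd by (simp add: dis)
    ultimately obtain i where i: "?L j = -{i}" by metis
    have "disputing_players a c j = {k. \<exists>i'. i' \<noteq> k \<and> ?L j = -{i'}}"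
      using False by (simp add: disputing_players_def eqc disputing_segment_iff[OF c] RNS)
    also have "\<dots> = -{i}" unfolding i by auto
    finally show ?thesis using i by simp
  qed
  have compl: "- disputed_goods a c = (\<Union>i. {j. ?L j = {i}})"
  proof -
    have "j \<notin> disputed_goods a c \<longleftrightarrow> (\<exists>i. ?L j = {i})" for j
      unfolding dis
      by (cases rule: leaders_cases[of c "column j a"])
         (simp_all add: singleton_neq_UNIV singleton_neq_UNIV[symmetric]
             Compl_singleton_neq Compl_singleton_neq[symmetric])
    then show ?thesis by auto
  qed
  have "(\<Sum>i\<in>UNIV. s $ i * undisputed_value a c i) = (\<Sum>i\<in>UNIV. \<Sum>j | ?L j = {i}. M j)"
    unfolding und sum_distrib_left by (intro sum.cong refl) (simp add: M_def)
  also have "\<dots> = sum M (- disputed_goods a c)"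
    unfolding compl by (subst sum.UNION_disjoint) auto
  finally have "delta_g a c s = sum M (- disputed_goods a c) + sum M (disputed_goods a c)"
    unfolding delta_g_def by (simp add: M_def dpl)
  also have "\<dots> = sum M UNIV"
    by (subst sum.union_disjoint[symmetric]) (auto simp: Un_commute)
  also have "M j = Max ((\<lambda>k. c $ k * s $ k) ` ?L j) * top_ratio c (column j a)" for j
  proof -
    have "M j = Max ((\<lambda>k. c $ k * s $ k * top_ratio c (column j a)) ` ?L j)"
      unfolding M_def by (intro arg_cong[of _ _ Max] image_cong) (auto simp: value_leader[OF c])
    then show ?thesis using Max_mult_right[of "?L j"] leaders_nonempty top_ratio_pos[OF c, of j] by simp
  qed
  then have "sum M UNIV = (\<Sum>j\<in>UNIV. Max ((\<lambda>k. c $ k * s $ k) ` ?L j) * top_ratio c (column j a))"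
    by simp
  finally show ?thesis .
qed

lemma sum_conditional:
  "(\<Sum>j\<in>UNIV. (if P j then x else y) * f j) = (\<Sum>j\<in>UNIV. y * f j) + (x - y) * (\<Sum>j | P j. f j)"
  for f :: "'m \<Rightarrow> real"
proof -
  have "(\<Sum>j\<in>UNIV. (if P j then x else y) * f j)
      = (\<Sum>j\<in>UNIV. y * f j + (if P j then (x - y) * f j else 0))"
    by (intro sum.cong) (auto simp: algebra_simps)
  then show ?thesis by (simp add: sum.distrib sum.If_cases sum_distrib_left)
qed

text \<open>Moving towards the vertex of \<open>i\<close> makes \<open>i\<close> the worst choice,
  so a good is charged to \<open>i\<close> only if nobody else leads it.\<close>

lemma delta_g_vertex_shift:
  assumes c: "c \<in> RNS_interior"
  shows "delta_g a c (vertex_shift c i) =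
    shift_rate c i * (pair_prod c i * total_ratio a c - pair_sum c * sole_ratio a c i)"
proof -
  let ?L = "\<lambda>j. leaders c (column j a)"
  note r = shift_rate_pos[OF c, of i]
  have "pair_sum c > 0" using RNS_interior_pos[OF c] by (simp add: pair_sum_def pair_prod_def sum_pos prod_pos)
  then have le: "shift_rate c i * (pair_prod c i - pair_sum c) \<le> shift_rate c i * pair_prod c i"
    using r by (intro mult_left_mono) auto
  have M: "Max ((\<lambda>k. c $ k * vertex_shift c i $ k) ` ?L j)
     = (if ?L j = {i} then shift_rate c i * (pair_prod c i - pair_sum c) else shift_rate c i * pair_prod c i)" for j
  proof (cases "?L j = {i}")
    case True
    then show ?thesis by (simp add: vertex_shift_mult)
  next
    case False
    then obtain k where k: "k \<in> ?L j" "k \<noteq> i" using leaders_nonempty[of c "column j a"] by blast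
    show ?thesis using False le k
      by (auto simp: vertex_shift_mult intro!: Max_eqI rev_image_eqI[of k])
  qed
  show ?thesis unfolding delta_g_eq[OF c] M sum_conditional sole_ratio_def total_ratio_def
    by (simp add: sum_distrib_left[symmetric] sum_negf algebra_simps)
qed

text \<open>With the signs reversed \<open>i\<close> is the best choice and takes every good for
  which \<open>i\<close> is among the leaders.\<close>

lemma delta_g_minus_vertex_shift:
  assumes c: "c \<in> RNS_interior"
  shows "delta_g a c (- vertex_shift c i) =
    shift_rate c i * (pair_sum c * shared_ratio a c i - pair_prod c i * total_ratio a c)"
proof -
  let ?L = "\<lambda>j. leaders c (column j a)"
  note r = shift_rate_pos[OF c, of i]
  have "pair_sum c > 0" using RNS_interior_pos[OF c] by (simp add: pair_sum_def pair_prod_def sum_pos prod_pos)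
  then have le: "shift_rate c i * (pair_prod c i - pair_sum c) \<le> shift_rate c i * pair_prod c i"
    using r by (intro mult_left_mono) auto
  have M: "Max ((\<lambda>k. c $ k * (- vertex_shift c i) $ k) ` ?L j)
     = (if i \<in> ?L j then - (shift_rate c i * (pair_prod c i - pair_sum c)) else - (shift_rate c i * pair_prod c i))" for j
  proof (cases "i \<in> ?L j")
    case True
    then show ?thesis using le
      by (auto simp: vertex_shift_mult intro!: Max_eqI rev_image_eqI[of i])
  next
    case False
    obtain k where k: "k \<in> ?L j" using leaders_nonempty[of c "column j a"] by blast
    then have "k \<noteq> i" using False by blast
    then show ?thesis using False k
      by (auto simp: vertex_shift_mult intro!: Max_eqI rev_image_eqI[of k])
  qed
  show ?thesis unfolding delta_g_eq[OF c] M sum_conditional shared_ratio_def total_ratio_def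
    by (simp add: sum_distrib_left[symmetric] sum_negf algebra_simps)
qed

end

section \<open>The geometry of the graph\<close>

lemma normalized_scaleR: "0 < r \<Longrightarrow> normalized (r *\<^sub>R x) = normalized x"
  by (simp add: normalized_def vec_eq_iff sum_distrib_left[symmetric])

lemma normalized_RNS: "x \<in> RNS \<Longrightarrow> normalized x = x"
  by (simp add: normalized_def vec_eq_iff RNS_sum)

text \<open>The point on the segment from \<open>v\<close> to the vertex of player \<open>i\<close> at which the ratio of every
  good for \<open>i\<close>, relative to the ratios for the other players, is \<open>\<rho>\<close> times that at \<open>v\<close>.\<close>

definition shifted :: "real^3 \<Rightarrow> 3 \<Rightarrow> real \<Rightarrow> real^3" where
  "shifted v i \<rho> = normalized (\<chi> k. if k = i then v $ i / \<rho> else v $ k)"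

lemma shifted_eq_scaleR:
  assumes "v \<in> RNS_interior" "0 < \<rho>"
  obtains r where "0 < r" "shifted v i \<rho> = r *\<^sub>R (\<chi> k. if k = i then v $ i / \<rho> else v $ k)"
proof -
  let ?y = "(\<chi> k. if k = i then v $ i / \<rho> else v $ k) :: real^3"
  have "0 < sum (($) ?y) UNIV" using assms RNS_interior_pos[OF assms(1)] by (intro sum_pos_vec) simp
  then show thesis using that[of "1 / sum (($) ?y) UNIV"]
    unfolding shifted_def normalized_eq_scaleR[of ?y] by simp
qed

lemma shifted_interior:
  assumes "v \<in> RNS_interior" "0 < \<rho>"
  shows "shifted v i \<rho> \<in> RNS_interior"
  unfolding shifted_def using assms RNS_interior_pos[OF assms(1)]
  by (intro normalized_in_RNS_interior) simp

lemma leaders_shifted: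
  assumes "v \<in> RNS_interior" "0 < \<rho>"
  shows "leaders (shifted v i \<rho>) x = leaders (\<chi> k. if k = i then v $ i / \<rho> else v $ k) x"
  using shifted_eq_scaleR[OF assms, of i] leaders_scaleR_left by metis

lemma leader_shifted_iff:
  assumes "v \<in> RNS_interior" "0 < \<rho>"
  shows "i \<in> leaders (shifted v i \<rho>) x \<longleftrightarrow> (\<forall>k. k \<noteq> i \<longrightarrow> x $ k / v $ k \<le> \<rho> * (x $ i / v $ i))"
  unfolding leaders_shifted[OF assms] unfolding leaders_def using assms
  by (auto simp: mult.commute)

lemma other_leader_shifted_iff:
  assumes "v \<in> RNS_interior" "0 < \<rho>" "k \<noteq> i"
  shows "k \<in> leaders (shifted v i \<rho>) x \<longleftrightarrow>
    \<rho> * (x $ i / v $ i) \<le> x $ k / v $ k \<and> (\<forall>l. l \<noteq> i \<longrightarrow> x $ l / v $ l \<le> x $ k / v $ k)"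
  unfolding leaders_shifted[OF assms(1,2)] unfolding leaders_def using assms
  by (auto simp: mult.commute)

text \<open>The parametrisation is multiplicative, so points on a line through a player's vertex are
  ordered by their parameters.\<close>

lemma shifted_shifted:
  assumes "v \<in> RNS_interior" "0 < \<rho>" "0 < \<rho>'"
  shows "shifted (shifted v i \<rho>) i \<rho>' = shifted v i (\<rho> * \<rho>')"
proof -
  obtain r where r: "0 < r" "shifted v i \<rho> = r *\<^sub>R (\<chi> k. if k = i then v $ i / \<rho> else v $ k)"
    using shifted_eq_scaleR[OF assms(1,2)] .
  have "(\<chi> k. if k = i then shifted v i \<rho> $ i / \<rho>' else shifted v i \<rho> $ k)
    = r *\<^sub>R (\<chi> k. if k = i then v $ i / (\<rho> * \<rho>') else v $ k)"
    by (simp add: r(2) vec_eq_iff)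
  then show ?thesis unfolding shifted_def[of _ _ \<rho>'] shifted_def[of v i "\<rho> * \<rho>'"]
    by (simp add: normalized_scaleR r(1))
qed

lemma shifted_one: "v \<in> RNS_interior \<Longrightarrow> shifted v i 1 = v"
proof -
  assume "v \<in> RNS_interior"
  moreover have "(\<chi> k. if k = i then v $ i / 1 else v $ k) = v" by (simp add: vec_eq_iff)
  ultimately show ?thesis by (simp add: shifted_def normalized_RNS RNS_interior_RNS)
qed

lemma shifted_neq:
  assumes "v \<in> RNS_interior" "0 < \<rho>" "\<rho> < 1"
  shows "shifted v i \<rho> \<noteq> v"
proof
  assume "shifted v i \<rho> = v"
  then have "leaders (shifted v i \<rho>) v = UNIV"
    using leaders_UNIV_iff[OF assms(1) RNS_interior_RNS[OF assms(1)]] by simp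
  then have "i \<in> leaders (shifted v i \<rho>) v" by simp
  moreover obtain k l where "k \<noteq> i" "l \<noteq> i" "k \<noteq> l" by (rule obtain_other_players)
  ultimately have "v $ k / v $ k \<le> \<rho> * (v $ i / v $ i)"
    using leader_shifted_iff[OF assms(1,2)] by blast
  then show False
    using RNS_interior_pos[OF assms(1), of k] RNS_interior_pos[OF assms(1), of i] assms by simp
qed

text \<open>The coordinates of the other players change by a common factor; comparing it with the
  change of the \<open>i\<close>-th coordinate recovers \<open>\<rho>\<close>. The value 1 gives
  \<open>v\<close>, and the vertex of the simplex would need \<open>\<rho> = 0\<close>, which
  \<open>w\<close> in the interior excludes.\<close>

lemma mem_segment_iff_shifted:
  assumes v: "v \<in> RNS_interior" and w: "w \<in> RNS_interior"
  shows "w \<in> closed_segment v (player_vertex i) \<longleftrightarrow> (\<exists>\<rho>. 0 < \<rho> \<and> \<rho> \<le> 1 \<and> w = shifted v i \<rho>)"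
    (is "?l \<longleftrightarrow> ?r")
proof
  assume ?l
  then have sub: "-{i} \<subseteq> leaders w v" using mem_segment_to_vertex_iff[OF w RNS_interior_RNS[OF v]] by simp
  define T where "T = top_ratio w v"
  have T: "0 < T"
    using top_ratio_ge[of v i w] RNS_interior_pos[OF v, of i] RNS_interior_pos[OF w, of i]
    unfolding T_def by (meson divide_pos_pos less_le_trans)
  define \<rho> where "\<rho> = v $ i / (T * w $ i)"
  have "v $ i / w $ i \<le> T" unfolding T_def by (rule top_ratio_ge)
  then have "v $ i \<le> T * w $ i" using RNS_interior_pos[OF w, of i] by (simp add: field_simps)
  then have \<rho>: "0 < \<rho>" "\<rho> \<le> 1" using T RNS_interior_pos[OF v, of i] RNS_interior_pos[OF w, of i]
    by (simp_all add: \<rho>_def)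
  have "v $ k = T * w $ k" if "k \<noteq> i" for k
    using top_ratio_leader[of k w v] sub that RNS_interior_pos[OF w, of k] unfolding T_def by auto
  moreover have "v $ i / \<rho> = T * w $ i" using RNS_interior_pos[OF v, of i] by (simp add: \<rho>_def)
  ultimately have "(\<chi> k. if k = i then v $ i / \<rho> else v $ k) = T *\<^sub>R w"
    by (simp add: vec_eq_iff)
  then have "w = shifted v i \<rho>"
    unfolding shifted_def using normalized_scaleR[OF T, of w] normalized_RNS[OF RNS_interior_RNS[OF w]] by simp
  then show ?r using \<rho> by blast
next
  assume ?r
  then obtain \<rho> where \<rho>: "0 < \<rho>" "\<rho> \<le> 1" "w = shifted v i \<rho>" by blast
  have "k \<in> leaders w v" if "k \<noteq> i" for k
    unfolding \<rho>(3) other_leader_shifted_iff[OF v \<rho>(1) that] using \<rho> RNS_interior_pos[OF v]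
    by (simp add: less_imp_neq[symmetric])
  then have "-{i} \<subseteq> leaders w v" by auto
  then show ?l using mem_segment_to_vertex_iff[OF w RNS_interior_RNS[OF v]] by simp
qed

lemma shifted_mem_open_segment:
  assumes v: "v \<in> RNS_interior" and \<rho>: "0 < \<rho>'" "\<rho>' < \<rho>" "\<rho> < 1"
  shows "shifted v i \<rho> \<in> open_segment v (shifted v i \<rho>')"
proof -
  let ?u = "shifted v i \<rho>"
  have \<rho>0: "0 < \<rho>" using \<rho> by simp
  have u: "?u \<in> RNS_interior" using shifted_interior[OF v \<rho>0] .
  have w: "shifted v i \<rho>' = shifted ?u i (\<rho>' / \<rho>)"
    using shifted_shifted[OF v \<rho>0, of "\<rho>' / \<rho>"] \<rho> \<rho>0 by simp
  have \<rho>r: "0 < \<rho>' / \<rho>" "\<rho>' / \<rho> < 1" using \<rho> \<rho>0 by simp_all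
  have wi: "shifted v i \<rho>' \<in> RNS_interior" using shifted_interior[OF v \<rho>(1)] .
  have "?u \<in> closed_segment v (player_vertex i)"
    unfolding mem_segment_iff_shifted[OF v u] using \<rho>0 \<rho> by (intro exI[of _ \<rho>]) simp
  moreover have "shifted v i \<rho>' \<in> closed_segment ?u (player_vertex i)"
    unfolding mem_segment_iff_shifted[OF u wi] using w \<rho>r by (intro exI[of _ "\<rho>' / \<rho>"]) simp
  ultimately have "?u \<in> closed_segment v (shifted v i \<rho>')"
    using between_trans_2[of "player_vertex i" v ?u "shifted v i \<rho>'"]
    by (simp add: between_mem_segment closed_segment_commute)
  moreover have "?u \<noteq> v" using shifted_neq[OF v \<rho>0 \<rho>(3)] .
  moreover have "?u \<noteq> shifted v i \<rho>'" using shifted_neq[OF u \<rho>r, of i] w by simp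
  ultimately show ?thesis by (simp add: open_segment_def)
qed

text \<open>Used for the two ends of an arc: one of them lies between the other and a player's
  vertex, so every arc points either towards this vertex or away from it.\<close>

lemma segment_comparable:
  assumes p: "p \<in> RNS_interior" and "v \<in> RNS_interior" "w \<in> RNS_interior"
    and "v \<in> closed_segment p (player_vertex i)" "w \<in> closed_segment p (player_vertex i)"
  shows "w \<in> closed_segment v (player_vertex i) \<or> v \<in> closed_segment w (player_vertex i)"
proof -
  have *: "shifted p i \<sigma> \<in> closed_segment (shifted p i \<rho>) (player_vertex i)"
    if "0 < \<sigma>" "\<sigma> \<le> \<rho>" for \<rho> \<sigma>
  proof -
    have "0 < \<rho>" using that by simp
    then have "shifted p i \<sigma> = shifted (shifted p i \<rho>) i (\<sigma> / \<rho>)"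
      using shifted_shifted[OF p, of \<rho> "\<sigma> / \<rho>"] that by simp
    then show ?thesis using that \<open>0 < \<rho>\<close>
      by (subst mem_segment_iff_shifted) (auto intro!: shifted_interior p exI[of _ "\<sigma> / \<rho>"])
  qed
  obtain \<rho> \<sigma> where "0 < \<rho>" "v = shifted p i \<rho>" "0 < \<sigma>" "w = shifted p i \<sigma>"
    using assms mem_segment_iff_shifted[OF p] by metis
  then show ?thesis using *[of \<sigma> \<rho>] *[of \<rho> \<sigma>] by (cases "\<sigma> \<le> \<rho>") auto
qed

context positive_values
begin

lemma graph_verts_interior: "v \<in> graph_verts a \<Longrightarrow> v \<in> RNS_interior"
  by (simp add: graph_verts_def)

lemma good_point_vert: "good_point a j \<in> graph_verts a"
  using good_point_interior by (auto simp: graph_verts_def)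

lemma mem_supporting_segment_iff:
  "v \<in> RNS_interior \<Longrightarrow> v \<in> supporting_segment a j i \<longleftrightarrow> -{i} \<subseteq> leaders v (column j a)"
  unfolding supporting_segment_def
  by (simp add: mem_segment_to_vertex_iff RNS_interior_RNS good_point_interior)

lemma good_point_mem_supporting_segment_iff:
  "good_point a j \<in> supporting_segment a k i \<longleftrightarrow> -{i} \<subseteq> leaders (column j a) (column k a)"
  unfolding mem_supporting_segment_iff[OF good_point_interior]
  unfolding good_point_eq normalized_eq_scaleR
  by (subst leaders_scaleR_left) (simp_all add: sum_pos_vec column_pos)

lemma segment_to_vertex_subset:
  assumes "v \<in> supporting_segment a j i" "u \<in> closed_segment v (player_vertex i)"
  shows "u \<in> supporting_segment a j i"
  using assms unfolding supporting_segment_def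
  by (meson closed_segment_subset convex_closed_segment ends_in_segment(2) subsetD)

text \<open>At a proper crossing, the ratios between the two goods are strictly ordered, so neither good
  lies on a supporting segment of the other.\<close>

lemma crossing_vert:
  assumes v: "v \<in> RNS_interior" and vj: "v \<in> supporting_segment a j i"
    and h: "leaders v (column h a) = {i}" and \<rho>: "0 < \<rho>" "\<rho> < 1"
    and k: "k \<noteq> i" and ik: "{i, k} \<subseteq> leaders (shifted v i \<rho>) (column h a)"
  shows "shifted v i \<rho> \<in> graph_verts a"
proof -
  let ?u = "shifted v i \<rho>" and ?H = "column h a" and ?J = "column j a"
  have u: "?u \<in> RNS_interior" using shifted_interior[OF v \<rho>(1)] .
  obtain l where l: "l \<noteq> i" "k \<noteq> l"
  proof -
    obtain p q where pq: "p \<noteq> i" "q \<noteq> i" "p \<noteq> q" by (rule obtain_other_players)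
    show thesis using that[of p] that[of q] pq by (cases "k = p") auto
  qed
  note all = all_players_iff[OF k l]
  show ?thesis
  \<comment> \<open>If the third player ties as well, the point is the plotted good \<open>h\<close>
    itself. Otherwise it is a crossing of the segment of \<open>j\<close> towards \<open>i\<close>
    with the segment of \<open>h\<close> towards \<open>l\<close>.\<close>
  proof (cases "l \<in> leaders ?u ?H")
    case True
    then have "leaders ?u ?H = UNIV" unfolding set_eq_iff all using ik by auto
    then have "?u = good_point a h"
      using leaders_UNIV_iff[OF u RNS_interior_RNS[OF good_point_interior], of h] by simp
    then show ?thesis using good_point_vert by simp
  next
    case False
    note vpos = RNS_interior_pos[OF v]
    have Jv: "0 < ?J $ n / v $ n" and Hv: "0 < ?H $ n / v $ n" for n
      using vpos[of n] column_pos by simp_all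
    have "-{i} \<subseteq> leaders v ?J" using vj mem_supporting_segment_iff[OF v] by simp
    then have kl: "k \<in> leaders v ?J" "l \<in> leaders v ?J" using k l by auto
    then have J: "?J $ i / v $ i \<le> ?J $ k / v $ k" "?J $ k / v $ k = ?J $ l / v $ l"
      unfolding leaders_def by (auto intro: antisym)
    have H1: "?H $ k / v $ k < ?H $ i / v $ i" using h k unfolding leaders_singleton_iff by simp
    have H2: "?H $ l / v $ l < ?H $ k / v $ k"
    proof -
      have "k \<in> leaders ?u ?H" using ik by simp
      then have *: "\<rho> * (?H $ i / v $ i) \<le> ?H $ k / v $ k" "\<forall>n. n \<noteq> i \<longrightarrow> ?H $ n / v $ n \<le> ?H $ k / v $ k"
        unfolding other_leader_shifted_iff[OF v \<rho>(1) k] by auto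
      moreover have "\<not> (\<rho> * (?H $ i / v $ i) \<le> ?H $ l / v $ l \<and> (\<forall>n. n \<noteq> i \<longrightarrow> ?H $ n / v $ n \<le> ?H $ l / v $ l))"
        using False unfolding other_leader_shifted_iff[OF v \<rho>(1) l(1)] .
      ultimately show ?thesis by (meson not_le order_trans)
    qed
    \<comment> \<open>The ratios at \<open>v\<close> satisfy \<open>i \<ge> k \<ge> l\<close>
      strictly for \<open>h\<close>, while for \<open>j\<close> players \<open>k\<close> and
      \<open>l\<close> tie and \<open>i\<close> is not above them. Quotients of these ratios compare
      the two goods directly and give each a sole leader relative to the other.\<close>
    have cancel: "?H $ n / ?J $ n = (?H $ n / v $ n) / (?J $ n / v $ n)"
        "?J $ n / ?H $ n = (?J $ n / v $ n) / (?H $ n / v $ n)" for n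
      using vpos[of n] by simp_all
    have "leaders ?J ?H = {i}"
    proof -
      have ki: "?H $ k / ?J $ k < ?H $ i / ?J $ i"
        unfolding cancel by (rule frac_less) (use Jv Hv J(1) H1 in \<open>auto intro: less_imp_le\<close>)
      have "?H $ l / ?J $ l < ?H $ k / ?J $ k"
        unfolding cancel J(2) using Jv[of l] H2 by (rule divide_strict_right_mono[rotated])
      then show ?thesis using ki unfolding leaders_singleton_iff all by auto
    qed
    moreover have "leaders ?H ?J = {l}"
    proof -
      have ki: "?J $ i / ?H $ i < ?J $ k / ?H $ k"
        unfolding cancel by (rule frac_less2) (use Jv Hv J(1) H1 in auto)
      have "?J $ k / ?H $ k < ?J $ l / ?H $ l"
        unfolding cancel J(2) by (rule frac_less2) (use Jv Hv H2 in auto)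
      then show ?thesis using ki unfolding leaders_singleton_iff all by auto
    qed
    ultimately have "s_independent a j h"
      unfolding s_independent_def good_point_mem_supporting_segment_iff Compl_singleton_subset_iff
      by (simp add: singleton_neq_UNIV Compl_singleton_neq[symmetric])
    moreover have "leaders ?u ?H = -{l}"
      unfolding set_eq_iff all using ik False k l by auto
    then have "?u \<in> supporting_segment a h l" using mem_supporting_segment_iff[OF u] by simp
    moreover have "?u \<in> closed_segment v (player_vertex i)"
      unfolding mem_segment_iff_shifted[OF v u] using \<rho> by (intro exI[of _ \<rho>]) simp
    then have "?u \<in> supporting_segment a j i" using segment_to_vertex_subset[OF vj] by blast
    ultimately show ?thesis using u unfolding graph_verts_def by blast
  qed
qed

text \<open>On the way towards the vertex of \<open>i\<close> the ratio of \<open>i\<close> for good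
  \<open>h\<close> shrinks until the strongest rival catches up; this first tie is a vertex of the
  graph by \<open>crossing_vert\<close>.\<close>

lemma next_vert:
  assumes v: "v \<in> RNS_interior" and vj: "v \<in> supporting_segment a j i"
    and h: "leaders v (column h a) = {i}"
  obtains \<rho> where "0 < \<rho>" "\<rho> < 1" "shifted v i \<rho> \<in> graph_verts a"
    "i \<in> leaders (shifted v i \<rho>) (column h a)"
proof -
  let ?H = "column h a"
  obtain k where k: "k \<noteq> i" "\<forall>n. n \<noteq> i \<longrightarrow> ?H $ n / v $ n \<le> ?H $ k / v $ k"
  proof -
    obtain p q where pq: "p \<noteq> i" "q \<noteq> i" "p \<noteq> q" by (rule obtain_other_players)
    note all = all_players_iff[OF pq]
    show thesis
    proof (cases "?H $ p / v $ p \<le> ?H $ q / v $ q")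
      case True
      then show ?thesis using pq by (intro that[of q]) (simp_all add: all)
    next
      case False
      then show ?thesis using pq by (intro that[of p]) (simp_all add: all)
    qed
  qed
  \<comment> \<open>The parameter at which the ratio of \<open>i\<close> has dropped to that of the
    best rival \<open>k\<close>.\<close>
  define \<rho> where "\<rho> = (?H $ k / v $ k) / (?H $ i / v $ i)"
  have pos: "0 < ?H $ n / v $ n" for n using RNS_interior_pos[OF v] column_pos by simp
  have "?H $ k / v $ k < ?H $ i / v $ i" using h k unfolding leaders_singleton_iff by simp
  then have \<rho>: "0 < \<rho>" "\<rho> < 1" unfolding \<rho>_def using pos[of i] pos[of k] by (simp_all only: divide_pos_pos divide_less_eq_1_pos)
  have \<rho>i: "\<rho> * (?H $ i / v $ i) = ?H $ k / v $ k"
    unfolding \<rho>_def using pos[of i] by (metis less_irrefl nonzero_eq_divide_eq)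
  have "i \<in> leaders (shifted v i \<rho>) ?H"
    unfolding leader_shifted_iff[OF v \<rho>(1)] \<rho>i using k by simp
  moreover have "k \<in> leaders (shifted v i \<rho>) ?H"
    unfolding other_leader_shifted_iff[OF v \<rho>(1) k(1)] \<rho>i using k by simp
  ultimately show thesis
    using that[OF \<rho>] crossing_vert[OF v vj h \<rho> k(1)] by simp
qed

text \<open>If \<open>i\<close> lost the lead strictly before the end of the arc, the tie supplied
  by \<open>next_vert\<close> would be a vertex inside the arc. At the end itself a tie is possible,
  so \<open>i\<close> is only claimed to be among the leaders there.\<close>

lemma leader_along_arc:
  assumes v: "v \<in> RNS_interior" and vj: "v \<in> supporting_segment a j i"
    and h: "leaders v (column h a) = {i}" and \<rho>: "0 < \<rho>"
    and empty: "graph_verts a \<inter> open_segment v (shifted v i \<rho>) = {}"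
  shows "i \<in> leaders (shifted v i \<rho>) (column h a)"
proof -
  obtain \<sigma> where \<sigma>: "0 < \<sigma>" "\<sigma> < 1" "shifted v i \<sigma> \<in> graph_verts a"
    "i \<in> leaders (shifted v i \<sigma>) (column h a)" using next_vert[OF v vj h] .
  have le: "\<sigma> \<le> \<rho>"
    using shifted_mem_open_segment[OF v \<rho>, of \<sigma> i] \<sigma> empty by (meson disjoint_iff not_le)
  have "0 < column h a $ i / v $ i" using RNS_interior_pos[OF v] column_pos by simp
  then have "\<sigma> * (column h a $ i / v $ i) \<le> \<rho> * (column h a $ i / v $ i)"
    using le by (intro mult_right_mono) auto
  then show ?thesis using \<sigma>(4) unfolding leader_shifted_iff[OF v \<rho>] leader_shifted_iff[OF v \<sigma>(1)]
    by (meson order_trans)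
qed

section \<open>Types of vertices, finiteness of the graph, existence of arcs\<close>

lemma vert_cases:
  assumes "v \<in> graph_verts a"
  obtains j where "leaders v (column j a) = UNIV"
  | i l j k where "i \<noteq> l" "leaders v (column j a) = -{i}" "leaders v (column k a) = -{l}"
proof -
  have v: "v \<in> RNS_interior" using assms by (rule graph_verts_interior)
  note pt = leaders_UNIV_iff[OF v RNS_interior_RNS[OF good_point_interior]]
  consider j where "v = good_point a j"
    | j k i l where "s_independent a j k" "v \<in> supporting_segment a j i" "v \<in> supporting_segment a k l"
    using assms unfolding graph_verts_def by blast
  then show thesis
  proof cases
    case (1 j)
    then show ?thesis using that(1)[of j] pt[of j] by simp
  next
    case (2 j k i l)
    have J: "leaders v (column j a) = UNIV \<or> leaders v (column j a) = -{i}"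
      and K: "leaders v (column k a) = UNIV \<or> leaders v (column k a) = -{l}"
      using 2 mem_supporting_segment_iff[OF v] by (simp_all add: Compl_singleton_subset_iff)
    \<comment> \<open>If both segments ran towards the same vertex, both goods would lie on one line
      through it, and the one nearer to the vertex would be on the supporting segment of the other,
      against s-independence.\<close>
    have "i \<noteq> l"
    proof
      assume il: "i = l"
      let ?e = "player_vertex i"
      have "v \<in> closed_segment (good_point a j) ?e" "v \<in> closed_segment (good_point a k) ?e"
        using 2 il by (simp_all add: supporting_segment_def)
      then have sub: "-{i} \<subseteq> leaders v (column j a)" "-{i} \<subseteq> leaders v (column k a)"
        using mem_segment_to_vertex_iff[OF v RNS_interior_RNS[OF good_point_interior]] by simp_all
      obtain p q where pq: "p \<noteq> i" "q \<noteq> i" "p \<noteq> q" by (rule obtain_other_players)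
      note all = all_players_iff[OF pq]
      define r where "r = top_ratio v (column j a)"
      define s where "s = top_ratio v (column k a)"
      have rs: "0 < r" "0 < s" unfolding r_def s_def using top_ratio_pos[OF v] by simp_all
      have J: "column j a $ n = r * v $ n" "column k a $ n = s * v $ n" if "n \<noteq> i" for n
        using sub that top_ratio_leader[of n v] RNS_interior_pos[OF v, of n]
        unfolding r_def s_def by (auto simp: field_simps)
      have JJ: "column j a $ n / column k a $ n = r / s" "column k a $ n / column j a $ n = s / r" if "n \<noteq> i" for n
        using J[OF that] RNS_interior_pos[OF v, of n] by simp_all
      have "(column j a $ i / column k a $ i \<le> r / s) \<or> (column k a $ i / column j a $ i \<le> s / r)"
        using rs column_pos[of j i] column_pos[of k i] by (simp add: divide_simps mult.commute) linarith
      then have "-{i} \<subseteq> leaders (column k a) (column j a) \<or> -{i} \<subseteq> leaders (column j a) (column k a)"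
        unfolding subset_iff leaders_def mem_Collect_eq all using JJ[OF pq(1)] JJ[OF pq(2)] pq by auto
      then show False using 2(1) unfolding s_independent_def good_point_mem_supporting_segment_iff by blast
    qed
    then show ?thesis using that J K by metis
  qed
qed

lemma finite_graph_verts: "finite (graph_verts a)"
proof -
  \<comment> \<open>There are finitely many index tuples, and each contributes at most one crossing:
    the segments fix two proportions of coordinates that share the third player \<open>n\<close>,
    hence the point up to scaling.\<close>
  define P where "P = (\<lambda>(j, k, i, l). {v \<in> RNS_interior. i \<noteq> l \<and> v \<in> supporting_segment a j i \<and> v \<in> supporting_segment a k l})"
  have "finite (P t)" for t
  proof -
    obtain j k i l where t: "t = (j, k, i, l)" by (cases t) auto
    have "v = w" if "v \<in> P t" "w \<in> P t" for v w
    proof -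
      have v: "v \<in> RNS_interior" and w: "w \<in> RNS_interior" and il: "i \<noteq> l" using that t by (auto simp: P_def)
      have S: "-{i} \<subseteq> leaders v (column j a)" "-{l} \<subseteq> leaders v (column k a)"
        "-{i} \<subseteq> leaders w (column j a)" "-{l} \<subseteq> leaders w (column k a)"
        using that t mem_supporting_segment_iff[OF v] mem_supporting_segment_iff[OF w] by (simp_all add: P_def)
      obtain n where n: "n \<noteq> i" "n \<noteq> l"
      proof -
        obtain p q where pq: "p \<noteq> i" "q \<noteq> i" "p \<noteq> q" by (rule obtain_other_players)
        show thesis using that[of p] that[of q] pq by (cases "l = p") auto
      qed
      have li: "l \<noteq> i" "n \<noteq> i" "l \<noteq> n" using il n by auto
      have ratio: "\<exists>r. v $ p = r * w $ p \<and> v $ q = r * w $ q"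
        if "p \<in> leaders v x" "q \<in> leaders v x" "p \<in> leaders w x" "q \<in> leaders w x" "x = column g a" for p q x g
      proof -
        have vx: "v $ p = x $ p / top_ratio v x" "v $ q = x $ q / top_ratio v x"
             "w $ p = x $ p / top_ratio w x" "w $ q = x $ q / top_ratio w x"
          using top_ratio_leader[OF that(1)] top_ratio_leader[OF that(2)]
             top_ratio_leader[OF that(3)] top_ratio_leader[OF that(4)]
             column_pos[of g p] column_pos[of g q] RNS_interior_pos[OF v] RNS_interior_pos[OF w]
             top_ratio_pos[OF v, of g] top_ratio_pos[OF w, of g] that(5)
          by (simp_all add: nonzero_eq_divide_eq less_imp_neq[symmetric] mult.commute)
        then show ?thesis using top_ratio_pos[OF w, of g] that(5)
          by (intro exI[of _ "top_ratio w x / top_ratio v x"]) simp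
      qed
      have mem: "l \<in> leaders v (column j a)" "n \<in> leaders v (column j a)"
        "l \<in> leaders w (column j a)" "n \<in> leaders w (column j a)"
        "i \<in> leaders v (column k a)" "n \<in> leaders v (column k a)"
        "i \<in> leaders w (column k a)" "n \<in> leaders w (column k a)"
        using S li il n by (auto simp: subset_iff)
      obtain r where r: "v $ l = r * w $ l" "v $ n = r * w $ n"
        using ratio[of l "column j a" n j] mem by auto
      obtain s where s: "v $ i = s * w $ i" "v $ n = s * w $ n"
        using ratio[of i "column k a" n k] mem by auto
      have "s = r" using r s RNS_interior_pos[OF w, of n] by simp
      then have vr: "v = r *\<^sub>R w" unfolding vec_eq_iff all_players_iff[OF li] using r s by simp
      have "0 < r" using r RNS_interior_pos[OF w, of n] RNS_interior_pos[OF v, of n] by (simp add: zero_less_mult_iff)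
      then have "normalized v = normalized w" unfolding vr by (rule normalized_scaleR)
      then show ?thesis using v w normalized_RNS RNS_interior_RNS by metis
    qed
    note same = this
    show ?thesis
    proof (cases "P t = {}")
      case True
      then show ?thesis by (simp only: finite.emptyI)
    next
      case False
      then obtain x where x: "x \<in> P t" by (metis ex_in_conv)
      have "P t \<subseteq> {x}"
      proof
        fix y assume "y \<in> P t"
        then show "y \<in> {x}" using same[OF _ x] by (simp only: singleton_iff)
      qed
      then show ?thesis by (rule finite_subset) simp
    qed
  qed
  then have "finite (range (good_point a) \<union> (\<Union>t. P t))" by simp
  moreover have "graph_verts a \<subseteq> range (good_point a) \<union> (\<Union>t. P t)"
  proof
    fix v assume vV: "v \<in> graph_verts a"
    then have v: "v \<in> RNS_interior" by (rule graph_verts_interior)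
    show "v \<in> range (good_point a) \<union> (\<Union>t. P t)"
    proof (rule vert_cases[OF vV])
      fix j assume "leaders v (column j a) = UNIV"
      then have "good_point a j = v"
        using leaders_UNIV_iff[OF v RNS_interior_RNS[OF good_point_interior]] by simp
      then show ?thesis by auto
    next
      fix i l j k assume "i \<noteq> l" "leaders v (column j a) = -{i}" "leaders v (column k a) = -{l}"
      then have "v \<in> P (j, k, i, l)" using v mem_supporting_segment_iff[OF v] by (simp add: P_def)
      then show ?thesis by blast
    qed
  qed
  ultimately show ?thesis by (rule finite_subset[rotated])
qed

text \<open>Finiteness of the graph provides a vertex nearest to \<open>v\<close> on the way to
  \<open>u\<close>; any vertex strictly in between would be nearer still. So a vertex in some
  direction along a supporting segment suffices to have an arc in this direction.\<close>

lemma nearest_vert: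
  assumes v: "v \<in> graph_verts a" and u: "u \<in> graph_verts a" "u \<noteq> v"
    and seg: "v \<in> supporting_segment a j i" "u \<in> supporting_segment a j i"
  obtains w where "graph_adj a v w" "w \<in> closed_segment v u"
proof -
  define S where "S = graph_verts a \<inter> closed_segment v u - {v}"
  have "finite S" "S \<noteq> {}" using finite_graph_verts u by (auto simp: S_def)
  then obtain w where w: "w \<in> S" "\<And>x. x \<in> S \<Longrightarrow> dist v w \<le> dist v x"
    using ex_is_arg_min_if_finite[of S "dist v"] by (metis is_arg_min_linorder)
  have wV: "w \<in> graph_verts a" "w \<noteq> v" "w \<in> closed_segment v u" using w by (auto simp: S_def)
  have sub: "closed_segment v u \<subseteq> supporting_segment a j i"
    using seg unfolding supporting_segment_def by (intro closed_segment_subset) auto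
  have "x \<notin> open_segment v w" if "x \<in> graph_verts a" for x
  proof
    assume x: "x \<in> open_segment v w"
    then have "x \<in> closed_segment v w" "x \<noteq> v" by (auto simp: open_segment_def)
    moreover have "closed_segment v w \<subseteq> closed_segment v u"
      using wV by (intro closed_segment_subset) auto
    ultimately have "x \<in> S" using that by (auto simp: S_def)
    then have "dist v w \<le> dist v x" by (rule w(2))
    moreover have "dist v x < dist v w"
      using dist_in_open_segment[OF x] by (simp add: dist_commute)
    ultimately show False by simp
  qed
  then have "graph_adj a v w"
    unfolding graph_adj_def using v wV seg(1) sub by blast
  then show thesis using that wV by blast
qed

end

section \<open>Descent along arcs\<close>

definition inv_sum :: "real^3 \<Rightarrow> real" where
  "inv_sum c = (\<Sum>k\<in>UNIV. 1 / c $ k)"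

text \<open>This is \<open>support_fun a (RD c)\<close> for interior \<open>c\<close>, see
  \<open>support_fun_eq_level\<close>. As a quotient of two functions that scale alike it ignores
  the normalisation of \<open>c\<close>.\<close>

definition level :: "real^'m^3 \<Rightarrow> real^3 \<Rightarrow> real" where
  "level a c = total_ratio a c / inv_sum c"

lemma inv_sum_pos: "c \<in> RNS_interior \<Longrightarrow> 0 < inv_sum c"
  using RNS_interior_pos[of c] by (auto simp: inv_sum_def intro!: sum_pos)

lemma top_ratio_scaleR:
  assumes "0 < r"
  shows "top_ratio (r *\<^sub>R c) x = top_ratio c x / r"
proof -
  have "top_ratio (r *\<^sub>R c) x = Max (range (\<lambda>k. x $ k / c $ k * (1 / r)))"
    by (simp add: top_ratio_def mult.commute)
  also have "\<dots> = top_ratio c x * (1 / r)"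
    unfolding top_ratio_def using assms by (intro Max_mult_right) auto
  finally show ?thesis by simp
qed

lemma total_ratio_scaleR: "0 < r \<Longrightarrow> total_ratio a (r *\<^sub>R c) = total_ratio a c / r"
  by (simp add: total_ratio_def top_ratio_scaleR sum_divide_distrib)

lemma shared_ratio_scaleR: "0 < r \<Longrightarrow> shared_ratio a (r *\<^sub>R c) i = shared_ratio a c i / r"
  by (simp add: shared_ratio_def top_ratio_scaleR leaders_scaleR_left sum_divide_distrib)

lemma inv_sum_scaleR: "inv_sum (r *\<^sub>R c) = inv_sum c / r"
  by (simp add: inv_sum_def sum_divide_distrib mult.commute)

lemma level_scaleR: "0 < r \<Longrightarrow> level a (r *\<^sub>R c) = level a c"
  by (simp add: level_def total_ratio_scaleR inv_sum_scaleR)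

lemma pair_prod_eq_divide:
  assumes "c \<in> RNS_interior"
  shows "pair_prod c i = (\<Prod>k\<in>UNIV. c $ k) / c $ i"
proof -
  have "(\<Prod>k\<in>UNIV. c $ k) = c $ i * pair_prod c i"
    unfolding pair_prod_def Compl_eq_Diff_UNIV by (rule prod.remove) auto
  then show ?thesis using RNS_interior_pos[OF assms, of i] by simp
qed

lemma pair_sum_eq_mult:
  assumes "c \<in> RNS_interior"
  shows "pair_sum c = (\<Prod>k\<in>UNIV. c $ k) * inv_sum c"
  by (simp add: pair_sum_def pair_prod_eq_divide[OF assms] inv_sum_def sum_distrib_left)

lemma prod_coords_pos: "c \<in> RNS_interior \<Longrightarrow> 0 < (\<Prod>k\<in>UNIV. c $ k)"
  by (intro prod_pos) (simp add: RNS_interior_pos)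

text \<open>Dividing by the product of all coordinates translates the sign of a directional
  derivative into a comparison with \<open>inv_sum\<close>, the denominator of
  \<open>level\<close>.\<close>

lemma pair_compare_iff:
  assumes "c \<in> RNS_interior"
  shows "pair_prod c i * F < pair_sum c * W \<longleftrightarrow> F / c $ i < inv_sum c * W"
    and "pair_sum c * W < pair_prod c i * F \<longleftrightarrow> inv_sum c * W < F / c $ i"
proof -
  have *: "pair_prod c i * F = (\<Prod>k\<in>UNIV. c $ k) * (F / c $ i)"
    "pair_sum c * W = (\<Prod>k\<in>UNIV. c $ k) * (inv_sum c * W)"
    by (simp_all add: pair_prod_eq_divide[OF assms] pair_sum_eq_mult[OF assms])
  show "pair_prod c i * F < pair_sum c * W \<longleftrightarrow> F / c $ i < inv_sum c * W"
    and "pair_sum c * W < pair_prod c i * F \<longleftrightarrow> inv_sum c * W < F / c $ i"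
    unfolding * by (rule mult_less_cancel_left_pos[OF prod_coords_pos[OF assms]])+
qed

context positive_values
begin

text \<open>Dividing \<open>v $ i\<close> by \<open>\<rho>\<close> multiplies the top ratio by
  \<open>\<rho>\<close> for the goods led by \<open>i\<close> alone and leaves it unchanged for the
  others, where a rival keeps the lead. Hence numerator and denominator of \<open>level\<close> are
  affine in \<open>\<rho>\<close> along the whole arc.\<close>

lemma level_shifted:
  assumes v: "v \<in> RNS_interior" and \<rho>: "0 < \<rho>" "\<rho> < 1"
    and lin: "\<And>h. leaders v (column h a) = {i} \<Longrightarrow> i \<in> leaders (shifted v i \<rho>) (column h a)"
  defines "y \<equiv> \<chi> k. if k = i then v $ i / \<rho> else v $ k"
  shows "total_ratio a y = total_ratio a v - (1 - \<rho>) * sole_ratio a v i"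
    and "shared_ratio a y i = \<rho> * sole_ratio a v i"
    and "inv_sum y = inv_sum v - (1 - \<rho>) / v $ i"
proof -
  let ?L = "\<lambda>h. leaders v (column h a)" and ?t = "\<lambda>h. top_ratio v (column h a)"
  have Ly: "leaders (shifted v i \<rho>) x = leaders y x" for x
    unfolding y_def by (rule leaders_shifted[OF v \<rho>(1)])
  have t: "top_ratio y (column h a) = (if ?L h = {i} then \<rho> else 1) * ?t h"
    and s: "i \<in> leaders y (column h a) \<longleftrightarrow> ?L h = {i}" for h
  proof -
    let ?H = "column h a"
    have pos: "0 < ?H $ i / v $ i" using RNS_interior_pos[OF v] column_pos by simp
    then have less: "\<rho> * (?H $ i / v $ i) < ?H $ i / v $ i"
      using mult_strict_right_mono[OF \<rho>(2) pos] by simp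
    show s: "i \<in> leaders y ?H \<longleftrightarrow> ?L h = {i}"
    proof
      assume "i \<in> leaders y ?H"
      then have "\<forall>k. k \<noteq> i \<longrightarrow> ?H $ k / v $ k \<le> \<rho> * (?H $ i / v $ i)"
        unfolding Ly[symmetric] leader_shifted_iff[OF v \<rho>(1)] .
      then show "?L h = {i}" unfolding leaders_singleton_iff using less by (meson le_less_trans)
    qed (use lin Ly in simp)
    show "top_ratio y ?H = (if ?L h = {i} then \<rho> else 1) * ?t h"
    proof (cases "?L h = {i}")
      case True
      then have "i \<in> leaders y ?H" using s by simp
      then have "top_ratio y ?H = ?H $ i / y $ i" by (rule top_ratio_leader)
      moreover have "?t h = ?H $ i / v $ i" using True by (intro top_ratio_leader) simp
      ultimately show ?thesis using True by (simp add: y_def)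
    next
      case False
      then obtain k where k: "k \<in> ?L h" "k \<noteq> i" using leaders_nonempty[of v ?H] by blast
      have max: "?H $ n / v $ n \<le> ?H $ k / v $ k" for n using k by (simp add: leaders_def)
      have "k \<in> leaders y ?H"
        unfolding Ly[symmetric] other_leader_shifted_iff[OF v \<rho>(1) k(2)]
        using max less by (meson le_less_trans less_imp_le order_trans)
      then have "top_ratio y ?H = ?H $ k / y $ k" by (rule top_ratio_leader)
      then show ?thesis using False k top_ratio_leader[OF k(1)] by (simp add: y_def)
    qed
  qed
  show "total_ratio a y = total_ratio a v - (1 - \<rho>) * sole_ratio a v i"
    unfolding total_ratio_def t sum_conditional sole_ratio_def by (simp add: algebra_simps)
  show "shared_ratio a y i = \<rho> * sole_ratio a v i"
    unfolding shared_ratio_def s sole_ratio_def sum_distrib_left by (intro sum.cong) (simp_all add: t)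
  obtain k l where kl: "k \<noteq> i" "l \<noteq> i" "k \<noteq> l" by (rule obtain_other_players)
  then show "inv_sum y = inv_sum v - (1 - \<rho>) / v $ i"
    by (simp add: inv_sum_def sum_distinct_players[of i k l] y_def diff_divide_distrib)
qed

text \<open>For a quotient of affine functions the cross-multiplied difference is linear in
  \<open>1 - \<rho>\<close>, so its sign is that of the derivative at \<open>v\<close>, however long
  the arc is.\<close>

lemma level_less_toward:
  assumes v: "v \<in> RNS_interior" and \<rho>: "0 < \<rho>" "\<rho> < 1"
    and lin: "\<And>h. leaders v (column h a) = {i} \<Longrightarrow> i \<in> leaders (shifted v i \<rho>) (column h a)"
    and less: "pair_prod v i * total_ratio a v < pair_sum v * sole_ratio a v i"
  shows "level a (shifted v i \<rho>) < level a v"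
proof -
  let ?F = "total_ratio a v" and ?W = "sole_ratio a v i" and ?S = "inv_sum v"
  define y where "y = (\<chi> k. if k = i then v $ i / \<rho> else v $ k)"
  note eq = level_shifted[OF v \<rho> lin, folded y_def]
  obtain r where r: "0 < r" "shifted v i \<rho> = r *\<^sub>R y"
    using shifted_eq_scaleR[OF v \<rho>(1)] unfolding y_def .
  have w: "shifted v i \<rho> \<in> RNS_interior" using v \<rho>(1) by (rule shifted_interior)
  have Sy: "0 < inv_sum y" using inv_sum_pos[OF w] r by (simp add: inv_sum_scaleR zero_less_divide_iff)
  have S: "0 < ?S" using v by (rule inv_sum_pos)
  have "?F / v $ i < ?S * ?W" using less pair_compare_iff(1)[OF v] by simp
  then have "(1 - \<rho>) * (?F / v $ i) < (1 - \<rho>) * (?S * ?W)"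
    by (rule mult_strict_left_mono) (use \<rho> in simp)
  then have "(?F - (1 - \<rho>) * ?W) * ?S < ?F * (?S - (1 - \<rho>) / v $ i)"
    by (simp add: algebra_simps)
  then have "total_ratio a y * ?S < ?F * inv_sum y" by (simp only: eq)
  then have "level a y < level a v"
    unfolding level_def using S Sy by (simp add: divide_less_eq less_divide_eq mult.commute)
  then show ?thesis using r level_scaleR[of r a y] by simp
qed

lemma level_less_away:
  assumes b: "b \<in> RNS_interior" and \<rho>: "0 < \<rho>" "\<rho> < 1"
    and lin: "\<And>h. leaders b (column h a) = {i} \<Longrightarrow> i \<in> leaders (shifted b i \<rho>) (column h a)"
  defines "v \<equiv> shifted b i \<rho>"
  assumes less: "pair_sum v * shared_ratio a v i < pair_prod v i * total_ratio a v"
  shows "level a b < level a v"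
proof -
  let ?W = "sole_ratio a b i"
  define y where "y = (\<chi> k. if k = i then b $ i / \<rho> else b $ k)"
  note eq = level_shifted[OF b \<rho> lin, folded y_def]
  obtain r where r: "0 < r" "v = r *\<^sub>R y"
    using shifted_eq_scaleR[OF b \<rho>(1)] unfolding y_def v_def .
  have v: "v \<in> RNS_interior" unfolding v_def using b \<rho>(1) by (rule shifted_interior)
  have Sy: "0 < inv_sum y" using inv_sum_pos[OF v] r by (simp add: inv_sum_scaleR zero_less_divide_iff)
  have S: "0 < inv_sum b" using b by (rule inv_sum_pos)
  have bi: "0 < b $ i" using b by (rule RNS_interior_pos)
  have "inv_sum v * shared_ratio a v i < total_ratio a v / v $ i"
    using less pair_compare_iff(2)[OF v] by simp
  \<comment> \<open>The derivative condition at \<open>v\<close> is carried over to the unnormalised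
    point \<open>y\<close>. Both sides acquire the factor \<open>\<rho> / r\<^sup>2\<close>: two
    factors \<open>1 / r\<close> from scaling, and \<open>\<rho>\<close> from the goods of
    \<open>i\<close> on one side and from \<open>y $ i = b $ i / \<rho>\<close> on the
    other.\<close>
  moreover have "inv_sum v * shared_ratio a v i = \<rho> / r\<^sup>2 * (inv_sum y * ?W)"
    using r by (simp add: inv_sum_scaleR shared_ratio_scaleR eq(2) power2_eq_square)
  moreover have "total_ratio a v / v $ i = \<rho> / r\<^sup>2 * (total_ratio a y / b $ i)"
    using r by (simp add: total_ratio_scaleR y_def power2_eq_square ac_simps)
  ultimately have "inv_sum y * ?W < total_ratio a y / b $ i"
    using r \<rho> by (simp add: mult_less_cancel_left_pos del: times_divide_eq_left times_divide_eq_right)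
  then have "(1 - \<rho>) * (inv_sum y * ?W) < (1 - \<rho>) * (total_ratio a y / b $ i)"
    by (rule mult_strict_left_mono) (use \<rho> in simp)
  then have "(total_ratio a y + (1 - \<rho>) * ?W) * inv_sum y < total_ratio a y * (inv_sum y + (1 - \<rho>) / b $ i)"
    by (simp add: algebra_simps)
  then have "total_ratio a b * inv_sum y < total_ratio a y * inv_sum b"
    using eq by simp
  then have "level a b < level a y"
    unfolding level_def using S Sy by (simp add: divide_less_eq less_divide_eq mult.commute)
  then show ?thesis using r level_scaleR[of r a y] by simp
qed

text \<open>The definite description is legitimate: two such players would make all three tie for
  \<open>v\<close> at \<open>w\<close>, forcing \<open>v = w\<close>.\<close>

lemma deriv_towards_toward:
  assumes v: "v \<in> RNS_interior" and w: "w \<in> RNS_interior" and vw: "v \<noteq> w"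
    and seg: "w \<in> closed_segment v (player_vertex i)"
  shows "deriv_towards a v w = delta_g a v (vertex_shift v i)"
proof -
  have "n = i" if n: "w \<in> closed_segment v (player_vertex n)" for n
  proof (rule ccontr)
    assume "n \<noteq> i"
    moreover have "-{n} \<subseteq> leaders w v" "-{i} \<subseteq> leaders w v"
      using n seg mem_segment_to_vertex_iff[OF w RNS_interior_RNS[OF v]] by simp_all
    ultimately have "leaders w v = UNIV" by auto
    then show False using leaders_UNIV_iff[OF w RNS_interior_RNS[OF v]] vw by simp
  qed
  then have "(THE n. w \<in> closed_segment v (player_vertex n)) = i" using seg by (intro the_equality)
  then show ?thesis unfolding deriv_towards_def using seg by auto
qed

lemma deriv_towards_away:
  assumes v: "v \<in> RNS_interior" and w: "w \<in> RNS_interior" and vw: "v \<noteq> w"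
    and seg: "v \<in> closed_segment w (player_vertex i)"
  shows "deriv_towards a v w = delta_g a v (- vertex_shift v i)"
proof -
  have uniq: "n = i" if n: "v \<in> closed_segment w (player_vertex n)" for n
  proof (rule ccontr)
    assume "n \<noteq> i"
    moreover have "-{n} \<subseteq> leaders v w" "-{i} \<subseteq> leaders v w"
      using n seg mem_segment_to_vertex_iff[OF v RNS_interior_RNS[OF w]] by simp_all
    ultimately have "leaders v w = UNIV" by auto
    then show False using leaders_UNIV_iff[OF v RNS_interior_RNS[OF w]] vw by simp
  qed
  have "leaders v w \<noteq> UNIV" using leaders_UNIV_iff[OF v RNS_interior_RNS[OF w]] vw by simp
  then have L: "leaders v w = -{i}"
    using seg mem_segment_to_vertex_iff[OF v RNS_interior_RNS[OF w]] Compl_singleton_subset_iff[of i "leaders v w"] by simp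
  \<comment> \<open>The first branch in \<open>deriv_towards\<close> has to be excluded. Exchanging
    the two points inverts the ratios, so \<open>i\<close> becomes the sole leader and
    \<open>w\<close> lies on no segment from \<open>v\<close> to a vertex.\<close>
  have "leaders w v = {i}"
    unfolding leaders_singleton_iff
  proof (intro allI impI)
    fix k assume "k \<noteq> i"
    then have "k \<in> leaders v w" "i \<notin> leaders v w" using L by auto
    then have "w $ i / v $ i < w $ k / v $ k"
      using top_ratio_ge[of w i v] unfolding leaders_eq_top_ratio by simp
    then show "v $ k / w $ k < v $ i / w $ i"
      using RNS_interior_pos[OF v, of k] RNS_interior_pos[OF v, of i]
        RNS_interior_pos[OF w, of k] RNS_interior_pos[OF w, of i]
      by (simp add: divide_less_eq less_divide_eq mult.commute)
  qed
  then have "w \<notin> closed_segment v (player_vertex n)" for n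
    using mem_segment_to_vertex_iff[OF w RNS_interior_RNS[OF v], of n]
    by (simp only: Compl_singleton_subset_iff singleton_neq_UNIV Compl_singleton_neq[symmetric] simp_thms)
  moreover have "(THE n. v \<in> closed_segment w (player_vertex n)) = i" using seg uniq by (intro the_equality)
  ultimately show ?thesis unfolding deriv_towards_def by auto
qed

lemma level_less_adj:
  assumes adj: "graph_adj a v w" and neg: "deriv_towards a v w < 0"
  shows "level a w < level a v"
proof -
  have v: "v \<in> RNS_interior" and w: "w \<in> RNS_interior" and vw: "v \<noteq> w"
    and empty: "graph_verts a \<inter> open_segment v w = {}"
    using adj graph_verts_interior by (auto simp: graph_adj_def)
  obtain j i where ji: "v \<in> supporting_segment a j i" "w \<in> supporting_segment a j i"
    using adj by (auto simp: graph_adj_def)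
  have "w \<in> closed_segment v (player_vertex i) \<or> v \<in> closed_segment w (player_vertex i)"
    using segment_comparable[OF good_point_interior v w] ji unfolding supporting_segment_def .
  then show ?thesis
  proof
    assume seg: "w \<in> closed_segment v (player_vertex i)"
    then obtain \<rho> where \<rho>: "0 < \<rho>" "\<rho> \<le> 1" "w = shifted v i \<rho>"
      using mem_segment_iff_shifted[OF v w] by metis
    then have \<rho>1: "\<rho> < 1" using vw shifted_one[OF v, of i] by (cases "\<rho> = 1") auto
    have "delta_g a v (vertex_shift v i) < 0"
      using neg deriv_towards_toward[OF v w vw seg] by simp
    then have "pair_prod v i * total_ratio a v < pair_sum v * sole_ratio a v i"
      unfolding delta_g_vertex_shift[OF v] using shift_rate_pos[OF v, of i]
      by (simp add: mult_less_0_iff)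
    then show ?thesis unfolding \<rho>(3)
      using leader_along_arc[OF v ji(1) _ \<rho>(1)] empty \<rho>(3)
      by (intro level_less_toward[OF v \<rho>(1) \<rho>1]) auto
  next
    assume seg: "v \<in> closed_segment w (player_vertex i)"
    then obtain \<rho> where \<rho>: "0 < \<rho>" "\<rho> \<le> 1" "v = shifted w i \<rho>"
      using mem_segment_iff_shifted[OF w v] by metis
    then have \<rho>1: "\<rho> < 1" using vw shifted_one[OF w, of i] by (cases "\<rho> = 1") auto
    have "delta_g a v (- vertex_shift v i) < 0"
      using neg deriv_towards_away[OF v w vw seg] by simp
    then have "pair_sum v * shared_ratio a v i < pair_prod v i * total_ratio a v"
      unfolding delta_g_minus_vertex_shift[OF v] using shift_rate_pos[OF v, of i]
      by (simp add: mult_less_0_iff)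
    then show ?thesis unfolding \<rho>(3)
      using leader_along_arc[OF w ji(2) _ \<rho>(1)] empty \<rho>(3)
      by (intro level_less_away[OF w \<rho>(1) \<rho>1]) (auto simp: open_segment_commute)
  qed
qed

lemma alg_step_level_less:
  assumes "alg_step a v w"
  shows "level a w < level a v" "w \<in> graph_verts a"
proof -
  obtain u where u: "graph_adj a v u" "deriv_towards a v u < 0" using assms by (auto simp: alg_step_def)
  then have "deriv_towards a v w < 0" "graph_adj a v w" using assms by (auto simp: alg_step_def)
  then show "level a w < level a v" "w \<in> graph_verts a"
    using level_less_adj by (auto simp: graph_adj_def)
qed

section \<open>Termination and the stopping test\<close>

lemma no_infinite_run:
  assumes v0: "v 0 \<in> graph_verts a" and run: "\<And>k::nat. alg_step a (v k) (v (Suc k))"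
  shows False
proof -
  have V: "v k \<in> graph_verts a" for k
    by (cases k) (use v0 alg_step_level_less(2)[OF run] in auto)
  have "strict_mono (\<lambda>k. - level a (v k))"
    unfolding strict_mono_Suc_iff using alg_step_level_less(1)[OF run] by simp
  then have "inj (\<lambda>k. - level a (v k))" by (rule strict_mono_imp_inj_on)
  then have "inj v" by (auto simp: inj_def)
  then have "infinite (range v)" by (rule range_inj_infinite)
  then show False using V finite_graph_verts finite_subset[of "range v"] by blast
qed

text \<open>With a negative derivative available, a step could fail only for lack of a lowest one,
  and the neighbours are finite in number.\<close>

lemma declared_optimal_if_no_step:
  assumes v: "v \<in> graph_verts a" and stop: "\<nexists>w. alg_step a v w"
  shows "declared_optimal a v"
proof (rule ccontr)
  assume "\<not> declared_optimal a v"
  then obtain u where u: "graph_adj a v u" "deriv_towards a v u < 0"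
    using v by (auto simp: declared_optimal_def not_le)
  have "finite {w. graph_adj a v w}"
    using finite_graph_verts by (rule finite_subset[rotated]) (auto simp: graph_adj_def)
  then obtain w where "is_arg_min (deriv_towards a v) (\<lambda>w. w \<in> {w. graph_adj a v w}) w"
    using u ex_is_arg_min_if_finite[of "{w. graph_adj a v w}" "deriv_towards a v"] by blast
  then have "alg_step a v w" using u by (auto simp: alg_step_def is_arg_min_linorder)
  then show False using stop by blast
qed

end

section \<open>Optimality at a final vertex\<close>

lemma obtain_ordered_players:
  fixes f :: "3 \<Rightarrow> real"
  obtains x y z where "y \<noteq> x" "z \<noteq> x" "y \<noteq> z" "f z \<le> f y" "f y \<le> f x"
proof -
  consider "f 3 \<le> f 2" "f 2 \<le> f 1" | "f 2 \<le> f 3" "f 3 \<le> f 1"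
    | "f 3 \<le> f 1" "f 1 \<le> f 2" | "f 1 \<le> f 3" "f 3 \<le> f 2"
    | "f 2 \<le> f 1" "f 1 \<le> f 3" | "f 1 \<le> f 2" "f 2 \<le> f 3"
    by linarith
  then show thesis
  proof cases
    case 1
    then show ?thesis by (intro that[of 2 1 3]) simp_all
  next
    case 2
    then show ?thesis by (intro that[of 3 1 2]) simp_all
  next
    case 3
    then show ?thesis by (intro that[of 1 2 3]) simp_all
  next
    case 4
    then show ?thesis by (intro that[of 3 2 1]) simp_all
  next
    case 5
    then show ?thesis by (intro that[of 1 3 2]) simp_all
  next
    case 6
    then show ?thesis by (intro that[of 2 3 1]) simp_all
  qed
qed

context positive_values
begin

lemma sole_ratio_eq: "sole_ratio a v i =
    (\<Sum>j\<in>UNIV. if leaders v (column j a) = {i} then top_ratio v (column j a) else 0)"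
  by (simp add: sole_ratio_def sum.If_cases)

lemma shared_ratio_eq: "shared_ratio a v i =
    (\<Sum>j\<in>UNIV. if i \<in> leaders v (column j a) then top_ratio v (column j a) else 0)"
  by (simp add: shared_ratio_def sum.If_cases)

lemma leaders_singleton_mem_iff:
  assumes "k \<noteq> i" "l \<noteq> i" "k \<noteq> l"
  shows "leaders c x = {i} \<longleftrightarrow> k \<notin> leaders c x \<and> l \<notin> leaders c x"
proof -
  have "i \<in> leaders c x \<or> k \<in> leaders c x \<or> l \<in> leaders c x"
    using leaders_nonempty[of c x] unfolding ex_in_conv[symmetric] not_all[symmetric]
    using all_players_iff[OF assms, of "\<lambda>n. n \<notin> leaders c x"] by blast
  then show ?thesis unfolding set_eq_iff all_players_iff[OF assms] using assms by auto
qed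

text \<open>Every good that \<open>i\<close> does not lead has a sole leader \<open>k\<close> or
  \<open>l\<close>, as a tie of just these two is excluded; so each good is counted once.\<close>

lemma total_ratio_split_shared:
  assumes kl: "k \<noteq> i" "l \<noteq> i" "k \<noteq> l"
    and no: "\<And>j. leaders v (column j a) \<noteq> -{i}"
  shows "total_ratio a v = sole_ratio a v k + sole_ratio a v l + shared_ratio a v i"
proof -
  let ?L = "\<lambda>j. leaders v (column j a)"
  have "\<not> (i \<notin> ?L j \<and> k \<in> ?L j \<and> l \<in> ?L j)" for j
    using no[of j] unfolding set_eq_iff all_players_iff[OF kl] using kl by auto
  moreover have "?L j = {k} \<longleftrightarrow> i \<notin> ?L j \<and> l \<notin> ?L j" "?L j = {l} \<longleftrightarrow> i \<notin> ?L j \<and> k \<notin> ?L j"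
    "\<not> (i \<notin> ?L j \<and> k \<notin> ?L j \<and> l \<notin> ?L j)" for j
    using leaders_singleton_mem_iff[of i k l v "column j a"] leaders_singleton_mem_iff[of i l k v "column j a"]
      leaders_singleton_mem_iff[of k i l v "column j a"] kl by auto
  ultimately show ?thesis
    unfolding sole_ratio_eq shared_ratio_eq total_ratio_def sum.distrib[symmetric]
    by (intro sum.cong) auto
qed

text \<open>Players \<open>k\<close> and \<open>l\<close> never lead the same good, so a good is led
  by exactly one of them or by \<open>i\<close> alone.\<close>

lemma total_ratio_split_sole:
  assumes kl: "k \<noteq> i" "l \<noteq> i" "k \<noteq> l"
    and no: "\<And>j. \<not> -{i} \<subseteq> leaders v (column j a)"
  shows "total_ratio a v = shared_ratio a v k + shared_ratio a v l + sole_ratio a v i"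
proof -
  let ?L = "\<lambda>j. leaders v (column j a)"
  have "\<not> (k \<in> ?L j \<and> l \<in> ?L j)" for j
    using no[of j] unfolding subset_iff all_players_iff[OF kl] using kl by auto
  then show ?thesis
    unfolding sole_ratio_eq shared_ratio_eq total_ratio_def sum.distrib[symmetric]
      leaders_singleton_mem_iff[OF kl]
    by (intro sum.cong) auto
qed

text \<open>If \<open>i\<close> is the sole leader of some good, \<open>next_vert\<close> yields a
  vertex towards \<open>i\<close>, hence an arc, and the stopping test applies to it. Otherwise the
  left side is 0.\<close>

lemma toward_bound:
  assumes opt: "declared_optimal a v" and sub: "-{i} \<subseteq> leaders v (column j a)"
  shows "pair_sum v * sole_ratio a v i \<le> pair_prod v i * total_ratio a v"
proof (cases "\<exists>h. leaders v (column h a) = {i}")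
  case True
  then obtain h where h: "leaders v (column h a) = {i}" ..
  have vV: "v \<in> graph_verts a" using opt by (simp add: declared_optimal_def)
  then have v: "v \<in> RNS_interior" by (rule graph_verts_interior)
  have vj: "v \<in> supporting_segment a j i" using sub mem_supporting_segment_iff[OF v] by simp
  obtain \<rho> where \<rho>: "0 < \<rho>" "\<rho> < 1" "shifted v i \<rho> \<in> graph_verts a"
    using next_vert[OF v vj h] by metis
  let ?u = "shifted v i \<rho>"
  have u: "?u \<in> RNS_interior" using \<rho>(3) by (rule graph_verts_interior)
  have useg: "?u \<in> closed_segment v (player_vertex i)"
    unfolding mem_segment_iff_shifted[OF v u] using \<rho> by (intro exI[of _ \<rho>]) simp
  obtain w where w: "graph_adj a v w" "w \<in> closed_segment v ?u"
    using nearest_vert[OF vV \<rho>(3) shifted_neq[OF v \<rho>(1,2)] vj segment_to_vertex_subset[OF vj useg]] .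
  have wi: "w \<in> RNS_interior" "v \<noteq> w" using w(1) graph_verts_interior by (auto simp: graph_adj_def)
  have "closed_segment v ?u \<subseteq> closed_segment v (player_vertex i)"
    using useg by (intro closed_segment_subset) auto
  then have "deriv_towards a v w = delta_g a v (vertex_shift v i)"
    using w(2) wi by (intro deriv_towards_toward[OF v]) auto
  moreover have "0 \<le> deriv_towards a v w" using opt w(1) by (simp add: declared_optimal_def)
  ultimately show ?thesis unfolding delta_g_vertex_shift[OF v]
    using shift_rate_pos[OF v, of i] by (simp add: zero_le_mult_iff)
next
  case False
  have v: "v \<in> RNS_interior" using opt graph_verts_interior by (simp add: declared_optimal_def)
  have "sole_ratio a v i = 0" using False by (simp add: sole_ratio_def)
  moreover have "0 \<le> pair_prod v i"
    using RNS_interior_pos[OF v] unfolding pair_prod_def by (intro less_imp_le prod_pos) simp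
  moreover have "0 \<le> total_ratio a v"
    using top_ratio_pos[OF v] unfolding total_ratio_def by (intro sum_nonneg less_imp_le) simp
  ultimately show ?thesis by simp
qed

text \<open>The good \<open>j\<close> itself is a vertex of the graph beyond \<open>v\<close> as
  seen from the vertex of \<open>i\<close>, so an arc leads in that direction.\<close>

lemma away_bound:
  assumes opt: "declared_optimal a v" and L: "leaders v (column j a) = -{i}"
  shows "pair_prod v i * total_ratio a v \<le> pair_sum v * shared_ratio a v i"
proof -
  let ?u = "good_point a j"
  have vV: "v \<in> graph_verts a" using opt by (simp add: declared_optimal_def)
  then have v: "v \<in> RNS_interior" by (rule graph_verts_interior)
  have vj: "v \<in> supporting_segment a j i" using L mem_supporting_segment_iff[OF v] by simp
  have "leaders v (column j a) \<noteq> UNIV" using L by auto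
  then have uv: "?u \<noteq> v" using leaders_UNIV_iff[OF v RNS_interior_RNS[OF good_point_interior], of j] by simp
  have uj: "?u \<in> supporting_segment a j i" by (simp add: supporting_segment_def)
  obtain w where w: "graph_adj a v w" "w \<in> closed_segment v ?u"
    using nearest_vert[OF vV good_point_vert uv vj uj] .
  have wi: "w \<in> RNS_interior" "v \<noteq> w" using w(1) graph_verts_interior by (auto simp: graph_adj_def)
  have "v \<in> closed_segment w (player_vertex i)"
    using between_trans_2[of ?u "player_vertex i" v w] vj w(2)
    by (simp add: between_mem_segment closed_segment_commute supporting_segment_def)
  then have "deriv_towards a v w = delta_g a v (- vertex_shift v i)"
    using wi by (intro deriv_towards_away[OF v]) auto
  moreover have "0 \<le> deriv_towards a v w" using opt w(1) by (simp add: declared_optimal_def)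
  ultimately show ?thesis unfolding delta_g_minus_vertex_shift[OF v]
    using shift_rate_pos[OF v, of i] by (simp add: zero_le_mult_iff)
qed

text \<open>Up to positive factors, the derivative in a direction without an arc is the sum of those in two
  directions that have one.\<close>

lemma declared_optimal_bounds:
  assumes opt: "declared_optimal a v"
  shows "pair_sum v * sole_ratio a v i \<le> pair_prod v i * total_ratio a v"
    and "pair_prod v i * total_ratio a v \<le> pair_sum v * shared_ratio a v i"
proof -
  let ?F = "total_ratio a v" and ?Q = "pair_sum v" and ?L = "\<lambda>j. leaders v (column j a)"
  \<comment> \<open>The three bounds have right and left sides that add up to this identity;
    subtracting two known bounds from the split of \<open>total_ratio\<close> leaves the missing
    one.\<close>
  have Q: "?Q * ?F = pair_prod v i * ?F + pair_prod v k * ?F + pair_prod v l * ?F"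
    if "k \<noteq> i" "l \<noteq> i" "k \<noteq> l" for i k l
    using that by (simp add: pair_sum_def sum_distinct_players[of i k l] algebra_simps)
  have away: "pair_prod v i * ?F \<le> ?Q * shared_ratio a v i"
    if kl: "k \<noteq> i" "l \<noteq> i" "k \<noteq> l"
      and T: "(\<And>j. ?L j \<noteq> -{i}) \<Longrightarrow> (\<exists>j. -{k} \<subseteq> ?L j) \<and> (\<exists>j. -{l} \<subseteq> ?L j)" for i k l
  proof (cases "\<exists>j. ?L j = -{i}")
    case True
    then show ?thesis using away_bound[OF opt] by blast
  next
    case False
    then have "(\<exists>j. -{k} \<subseteq> ?L j) \<and> (\<exists>j. -{l} \<subseteq> ?L j)" by (intro T) simp
    then have "?Q * sole_ratio a v k \<le> pair_prod v k * ?F" "?Q * sole_ratio a v l \<le> pair_prod v l * ?F"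
      using toward_bound[OF opt] by blast+
    moreover have "?F = sole_ratio a v k + sole_ratio a v l + shared_ratio a v i"
      using False by (intro total_ratio_split_shared kl) auto
    then have "?Q * ?F = ?Q * sole_ratio a v k + ?Q * sole_ratio a v l + ?Q * shared_ratio a v i"
      by (metis distrib_left)
    ultimately show ?thesis using Q[OF kl] by linarith
  qed
  have toward: "?Q * sole_ratio a v i \<le> pair_prod v i * ?F"
    if kl: "k \<noteq> i" "l \<noteq> i" "k \<noteq> l"
      and T: "(\<And>j. \<not> -{i} \<subseteq> ?L j) \<Longrightarrow> (\<exists>j. ?L j = -{k}) \<and> (\<exists>j. ?L j = -{l})" for i k l
  proof (cases "\<exists>j. -{i} \<subseteq> ?L j")
    case True
    then show ?thesis using toward_bound[OF opt] by blast
  next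
    case False
    then have "(\<exists>j. ?L j = -{k}) \<and> (\<exists>j. ?L j = -{l})" by (intro T) simp
    then have "pair_prod v k * ?F \<le> ?Q * shared_ratio a v k" "pair_prod v l * ?F \<le> ?Q * shared_ratio a v l"
      using away_bound[OF opt] by blast+
    moreover have "?F = shared_ratio a v k + shared_ratio a v l + sole_ratio a v i"
      using False by (intro total_ratio_split_sole kl) auto
    then have "?Q * ?F = ?Q * shared_ratio a v k + ?Q * shared_ratio a v l + ?Q * sole_ratio a v i"
      by (metis distrib_left)
    ultimately show ?thesis using Q[OF kl] by linarith
  qed
  have "v \<in> graph_verts a" using opt by (simp add: declared_optimal_def)
  then have arcs: "(\<exists>j. ?L j = UNIV) \<or> (\<exists>p q j k. p \<noteq> q \<and> ?L j = -{p} \<and> ?L k = -{q})"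
  proof (rule vert_cases)
    fix j assume "?L j = UNIV"
    then show ?thesis by (intro disjI1 exI)
  next
    fix p q j k assume "p \<noteq> q" "?L j = -{p}" "?L k = -{q}"
    then show ?thesis by (intro disjI2 exI conjI)
  qed
  obtain k l where kl: "k \<noteq> i" "l \<noteq> i" "k \<noteq> l" by (rule obtain_other_players)
  note all = all_players_iff[OF kl]
  \<comment> \<open>A vertex without a good on it has goods on two different lines through players'
    vertices; if none belongs to \<open>i\<close>, the lines are those of \<open>k\<close> and
    \<open>l\<close>.\<close>
  have two: "(\<exists>j. ?L j = -{k}) \<and> (\<exists>j. ?L j = -{l})"
    if ni: "\<And>j. ?L j \<noteq> -{i}" and nu: "\<And>j. ?L j \<noteq> UNIV"
  proof -
    have "\<exists>p q j h. p \<noteq> q \<and> ?L j = -{p} \<and> ?L h = -{q}" using arcs nu by simp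
    then obtain p q j h where pq: "p \<noteq> q" "?L j = -{p}" "?L h = -{q}" by (elim exE conjE)
    have "p \<noteq> i" using pq(2) ni[of j] by auto
    moreover have "q \<noteq> i" using pq(3) ni[of h] by auto
    moreover have any: "n = i \<or> n = k \<or> n = l" for n
      using all[of "\<lambda>n. n = i \<or> n = k \<or> n = l"] by simp
    ultimately have "p = k \<and> q = l \<or> p = l \<and> q = k" using pq(1) any[of p] any[of q] by auto
    then show ?thesis using pq(2,3) by auto
  qed
  show "?Q * sole_ratio a v i \<le> pair_prod v i * ?F"
  proof (rule toward[OF kl])
    assume no: "\<And>j. \<not> -{i} \<subseteq> ?L j"
    have "?L j \<noteq> -{i}" "?L j \<noteq> UNIV" for j using no[of j] by auto
    then show "(\<exists>j. ?L j = -{k}) \<and> (\<exists>j. ?L j = -{l})" by (rule two)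
  qed
  show "pair_prod v i * ?F \<le> ?Q * shared_ratio a v i"
  proof (rule away[OF kl])
    assume no: "\<And>j. ?L j \<noteq> -{i}"
    show "(\<exists>j. -{k} \<subseteq> ?L j) \<and> (\<exists>j. -{l} \<subseteq> ?L j)"
    proof (cases "\<exists>j. ?L j = UNIV")
      case True
      then obtain j where "?L j = UNIV" ..
      then show ?thesis by (intro conjI exI[of _ j]) simp_all
    next
      case False
      then have "(\<exists>j. ?L j = -{k}) \<and> (\<exists>j. ?L j = -{l})" using no by (intro two) simp_all
      then obtain j h where "?L j = -{k}" "?L h = -{l}" by (elim conjE exE)
      then show ?thesis by (intro conjI exI[of _ j] exI[of _ h]) simp_all
    qed
  qed
qed

lemma delta_g_nonneg:
  assumes opt: "declared_optimal a v" and s: "(\<Sum>k\<in>UNIV. s $ k) = 0"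
  shows "0 \<le> delta_g a v s"
proof -
  let ?F = "total_ratio a v" and ?Q = "pair_sum v" and ?L = "\<lambda>j. leaders v (column j a)"
  let ?t = "\<lambda>j. top_ratio v (column j a)"
  have v: "v \<in> RNS_interior" using opt graph_verts_interior by (simp add: declared_optimal_def)
  define \<sigma> where "\<sigma> k = v $ k * s $ k" for k
  obtain x y z where xyz: "y \<noteq> x" "z \<noteq> x" "y \<noteq> z" and le: "\<sigma> z \<le> \<sigma> y" "\<sigma> y \<le> \<sigma> x"
    by (rule obtain_ordered_players)
  note all = all_players_iff[OF xyz]
  have Max: "Max (\<sigma> ` ?L j) = (if x \<in> ?L j then \<sigma> x else if ?L j = {z} then \<sigma> z else \<sigma> y)" for j
  proof -
    have top: "Max (\<sigma> ` ?L j) = \<sigma> n" if "n \<in> ?L j" "\<forall>m. m \<in> ?L j \<longrightarrow> \<sigma> m \<le> \<sigma> n" for n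
      using that by (intro Max_eqI) auto
    have "y \<in> ?L j" if "x \<notin> ?L j" "?L j \<noteq> {z}"
      using leaders_singleton_mem_iff[of x z y v "column j a"] that xyz by auto
    then show ?thesis using top[of x] top[of y] le unfolding all by auto
  qed
  have "delta_g a v s = (\<Sum>j\<in>UNIV. Max (\<sigma> ` ?L j) * ?t j)"
    unfolding delta_g_eq[OF v] \<sigma>_def ..
  \<comment> \<open>Summation by parts around the middle value. Both differences are nonnegative, so
    only the bound away from \<open>x\<close> and the one towards \<open>z\<close> enter.\<close>
  also have "\<dots> = (\<Sum>j\<in>UNIV. \<sigma> y * ?t j + (\<sigma> x - \<sigma> y) * (if x \<in> ?L j then ?t j else 0)
      - (\<sigma> y - \<sigma> z) * (if ?L j = {z} then ?t j else 0))"
    unfolding Max using xyz by (intro sum.cong) (auto simp: algebra_simps)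
  also have "\<dots> = \<sigma> y * ?F + (\<sigma> x - \<sigma> y) * shared_ratio a v x - (\<sigma> y - \<sigma> z) * sole_ratio a v z"
    unfolding sole_ratio_eq shared_ratio_eq total_ratio_def
    by (simp add: sum.distrib sum_subtractf sum_distrib_left)
  finally have D: "delta_g a v s = \<dots>" .
  have "?Q * delta_g a v s = \<sigma> y * (?Q * ?F) + (\<sigma> x - \<sigma> y) * (?Q * shared_ratio a v x)
      - (\<sigma> y - \<sigma> z) * (?Q * sole_ratio a v z)"
    unfolding D by (simp add: algebra_simps)
  moreover have "(\<sigma> x - \<sigma> y) * (pair_prod v x * ?F) \<le> (\<sigma> x - \<sigma> y) * (?Q * shared_ratio a v x)"
    using le declared_optimal_bounds(2)[OF opt] by (intro mult_left_mono) auto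
  moreover have "(\<sigma> y - \<sigma> z) * (?Q * sole_ratio a v z) \<le> (\<sigma> y - \<sigma> z) * (pair_prod v z * ?F)"
    using le declared_optimal_bounds(1)[OF opt] by (intro mult_left_mono) auto
  moreover have "\<sigma> y * (?Q * ?F) + (\<sigma> x - \<sigma> y) * (pair_prod v x * ?F) - (\<sigma> y - \<sigma> z) * (pair_prod v z * ?F)
    = ?F * (pair_prod v x * \<sigma> x + pair_prod v y * \<sigma> y + pair_prod v z * \<sigma> z)"
    using xyz by (simp add: pair_sum_def sum_distinct_players[of x y z] algebra_simps)
  \<comment> \<open>This is the condition that the shift sums to 0, multiplied by the product of the
    coordinates of \<open>v\<close>.\<close>
  moreover have "pair_prod v x * \<sigma> x + pair_prod v y * \<sigma> y + pair_prod v z * \<sigma> z = 0"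
  proof -
    have "pair_prod v n * \<sigma> n = (\<Prod>k\<in>UNIV. v $ k) * s $ n" for n
      using RNS_interior_pos[OF v, of n] by (simp add: pair_prod_eq_divide[OF v] \<sigma>_def)
    then show ?thesis
      using s xyz by (simp add: sum_distinct_players[of x y z] distrib_left[symmetric])
  qed
  ultimately have "0 \<le> ?Q * delta_g a v s" by simp
  moreover have "0 < ?Q" using pair_sum_eq_mult[OF v] prod_coords_pos[OF v] inv_sum_pos[OF v] by simp
  ultimately show ?thesis by (simp add: zero_le_mult_iff)
qed

end

section \<open>Pareto faces\<close>

context positive_values
begin

section \<open>Maximisers of the weighted value\<close>

lemma RD_nth: "RD v $ i = 1 / v $ i / inv_sum v"
  by (simp add: RD_def normalized_def inv_sum_def)

definition leader_allocations :: "real^3 \<Rightarrow> (real^'m^3) set" where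
  "leader_allocations v = {X. allocation X \<and> (\<forall>i j. i \<notin> leaders v (column j a) \<longrightarrow> X $ i $ j = 0)}"

lemma weighted_value_eq:
  "(\<Sum>i\<in>UNIV. RD v $ i * alloc_value a X $ i)
    = (\<Sum>j\<in>UNIV. \<Sum>i\<in>UNIV. a $ i $ j / v $ i * X $ i $ j) / inv_sum v"
proof -
  have "(\<Sum>i\<in>UNIV. RD v $ i * alloc_value a X $ i)
      = (\<Sum>i\<in>UNIV. \<Sum>j\<in>UNIV. a $ i $ j / v $ i * X $ i $ j) / inv_sum v"
    by (simp add: RD_nth alloc_value_def sum_distrib_left sum_divide_distrib ac_simps)
  then show ?thesis by (subst sum.swap)
qed

text \<open>The shares of a good are weights summing to 1, so its weighted value is an average of
  its ratios and at most the largest of them.\<close>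

lemma weighted_value_le_level:
  assumes v: "v \<in> RNS_interior" and X: "allocation X"
  shows "(\<Sum>i\<in>UNIV. RD v $ i * alloc_value a X $ i) \<le> level a v"
proof -
  have "(\<Sum>i\<in>UNIV. a $ i $ j / v $ i * X $ i $ j) \<le> top_ratio v (column j a)" for j
  proof -
    have "(\<Sum>i\<in>UNIV. a $ i $ j / v $ i * X $ i $ j)
        \<le> (\<Sum>i\<in>UNIV. top_ratio v (column j a) * X $ i $ j)"
      using X top_ratio_ge[of "column j a" _ v]
      by (intro sum_mono mult_right_mono) (auto simp: allocation_def column_def)
    also have "\<dots> = top_ratio v (column j a)"
      using X by (simp add: sum_distrib_left[symmetric] allocation_def)
    finally show ?thesis .
  qed
  then have "(\<Sum>j\<in>UNIV. \<Sum>i\<in>UNIV. a $ i $ j / v $ i * X $ i $ j) \<le> total_ratio a v"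
    unfolding total_ratio_def by (intro sum_mono)
  then show ?thesis unfolding weighted_value_eq level_def
    using inv_sum_pos[OF v] by (intro divide_right_mono) auto
qed

lemma weighted_value_leader_allocation:
  assumes "X \<in> leader_allocations v"
  shows "(\<Sum>i\<in>UNIV. RD v $ i * alloc_value a X $ i) = level a v"
proof -
  have "(\<Sum>i\<in>UNIV. a $ i $ j / v $ i * X $ i $ j) = top_ratio v (column j a)" for j
  proof -
    have "(\<Sum>i\<in>UNIV. a $ i $ j / v $ i * X $ i $ j)
        = (\<Sum>i\<in>UNIV. top_ratio v (column j a) * X $ i $ j)"
    proof (intro sum.cong refl)
      fix i
      show "a $ i $ j / v $ i * X $ i $ j = top_ratio v (column j a) * X $ i $ j"
      proof (cases "i \<in> leaders v (column j a)")
        case True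
        then show ?thesis unfolding top_ratio_leader[OF True] by (simp add: column_def)
      next
        case False
        then have "X $ i $ j = 0" using assms by (simp add: leader_allocations_def)
        then show ?thesis by simp
      qed
    qed
    also have "\<dots> = top_ratio v (column j a)"
      using assms by (simp add: sum_distrib_left[symmetric] allocation_def leader_allocations_def)
    finally show ?thesis .
  qed
  then show ?thesis by (simp add: weighted_value_eq level_def total_ratio_def)
qed

text \<open>Links the formula for the derivative with allocations: each good goes entirely to a
  leader at which the maximum in \<open>delta_g_eq\<close> is attained.\<close>

lemma leader_allocation_delta_g:
  assumes v: "v \<in> RNS_interior"
  obtains X where "X \<in> leader_allocations v" "(\<Sum>i\<in>UNIV. s $ i * alloc_value a X $ i) = delta_g a v s"
proof -
  let ?L = "\<lambda>j. leaders v (column j a)"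
  have "\<exists>n. n \<in> ?L j \<and> v $ n * s $ n = Max ((\<lambda>k. v $ k * s $ k) ` ?L j)" for j
  proof -
    have "Max ((\<lambda>k. v $ k * s $ k) ` ?L j) \<in> (\<lambda>k. v $ k * s $ k) ` ?L j"
      using leaders_nonempty by (intro Max_in) auto
    then show ?thesis by (elim imageE) (auto intro: sym)
  qed
  then obtain n where n: "n j \<in> ?L j" "v $ n j * s $ n j = Max ((\<lambda>k. v $ k * s $ k) ` ?L j)" for j
    by metis
  define X :: "real^'m^3" where "X = (\<chi> i j. if i = n j then 1 else 0)"
  have "X \<in> leader_allocations v"
    unfolding leader_allocations_def allocation_def X_def using n(1) by auto
  moreover have "(\<Sum>i\<in>UNIV. s $ i * alloc_value a X $ i) = delta_g a v s"
  proof -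
    have "(\<Sum>i\<in>UNIV. s $ i * alloc_value a X $ i)
        = (\<Sum>i\<in>UNIV. \<Sum>j\<in>UNIV. if i = n j then s $ i * a $ i $ j else 0)"
      by (simp add: alloc_value_def X_def sum_distrib_left if_distrib cong: if_cong)
    also have "\<dots> = (\<Sum>j\<in>UNIV. s $ n j * a $ n j $ j)"
      by (subst sum.swap) simp
    also have "\<dots> = delta_g a v s"
      unfolding delta_g_eq[OF v] n(2)[symmetric]
      by (intro sum.cong) (simp_all add: value_leader[OF v n(1)])
    finally show ?thesis .
  qed
  ultimately show thesis by (rule that)
qed

lemma support_fun_eq_level:
  assumes v: "v \<in> RNS_interior"
  shows "support_fun a (RD v) = level a v"
proof -
  \<comment> \<open>The shift 0 merely serves to produce some leader allocation.\<close>
  obtain X where X: "X \<in> leader_allocations v" by (rule leader_allocation_delta_g[OF v, of 0])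
  show ?thesis unfolding support_fun_def
  proof (rule cSup_eq_maximum)
    have "alloc_value a X \<in> IPS a"
      unfolding IPS_def using X by (intro CollectI exI[of _ X]) (simp add: leader_allocations_def)
    then show "level a v \<in> (\<lambda>y. \<Sum>i\<in>UNIV. RD v $ i * y $ i) ` IPS a"
      by (rule rev_image_eqI) (rule weighted_value_leader_allocation[OF X, symmetric])
    fix t assume "t \<in> (\<lambda>y. \<Sum>i\<in>UNIV. RD v $ i * y $ i) ` IPS a"
    then obtain Y where "allocation Y" "t = (\<Sum>i\<in>UNIV. RD v $ i * alloc_value a Y $ i)"
      unfolding IPS_def by blast
    then show "t \<le> level a v" using weighted_value_le_level[OF v] by simp
  qed
qed

lemma leader_allocation_in_face:
  assumes "v \<in> RNS_interior" "X \<in> leader_allocations v"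
  shows "alloc_value a X \<in> pareto_face a v"
proof -
  have "alloc_value a X \<in> IPS a"
    unfolding IPS_def using assms(2) by (intro CollectI exI[of _ X]) (simp add: leader_allocations_def)
  then show ?thesis
    unfolding pareto_face_def support_hyperplane_def support_fun_eq_level[OF assms(1)]
    using weighted_value_leader_allocation[OF assms(2)] by simp
qed

text \<open>All weights \<open>RD v\<close> are positive, so a Pareto improvement would raise the
  weighted value above its maximum.\<close>

lemma pareto_optimal_if_in_face:
  assumes v: "v \<in> RNS_interior" and X: "allocation X" "alloc_value a X \<in> pareto_face a v"
  shows "pareto_optimal a X"
proof -
  have RD: "0 < RD v $ i" for i
    using RNS_interior_pos[OF v, of i] inv_sum_pos[OF v] by (simp add: RD_nth)
  have False if Y: "allocation Y" "\<forall>i. alloc_value a X $ i \<le> alloc_value a Y $ i"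
    "alloc_value a X $ k < alloc_value a Y $ k" for Y k
  proof -
    have "(\<Sum>i\<in>UNIV. RD v $ i * alloc_value a X $ i) < (\<Sum>i\<in>UNIV. RD v $ i * alloc_value a Y $ i)"
      by (rule sum_strict_mono_ex1) (use Y RD in \<open>auto intro!: mult_left_mono less_imp_le exI[of _ k]\<close>)
    also have "\<dots> \<le> level a v" using v Y(1) by (rule weighted_value_le_level)
    finally show False
      using X(2) by (simp add: pareto_face_def support_hyperplane_def support_fun_eq_level[OF v])
  qed
  then show ?thesis using X(1) unfolding pareto_optimal_def by blast
qed

lemma convex_leader_allocations: "convex (leader_allocations v)"
  unfolding convex_def leader_allocations_def allocation_def
  by (auto simp: sum.distrib sum_distrib_left[symmetric])

lemma compact_leader_allocations: "compact (leader_allocations v)"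
proof -
  have "leader_allocations v = (\<Inter>i. \<Inter>j. {X. 0 \<le> X $ i $ j}) \<inter> (\<Inter>j. {X. (\<Sum>i\<in>UNIV. X $ i $ j) = 1}) \<inter>
      (\<Inter>j. \<Inter>i\<in>-leaders v (column j a). {X. X $ i $ j = 0})"
    by (auto simp: leader_allocations_def allocation_def)
  also have "closed \<dots>"
    by (intro closed_Int closed_INT ballI closed_Collect_le closed_Collect_eq continuous_intros)
  finally have "closed (leader_allocations v)" .
  moreover have "bounded (leader_allocations v)"
  proof (rule boundedI)
    fix X assume "X \<in> leader_allocations v"
    then have X: "0 \<le> X $ i $ j" "(\<Sum>i\<in>UNIV. X $ i $ j) = 1" for i j
      by (auto simp: leader_allocations_def allocation_def)
    have "norm X \<le> (\<Sum>i\<in>UNIV. norm (X $ i))"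
      unfolding norm_vec_def by (rule L2_set_le_sum) simp
    also have "\<dots> \<le> (\<Sum>i\<in>UNIV. \<Sum>j\<in>UNIV. \<bar>X $ i $ j\<bar>)"
      by (intro sum_mono norm_le_l1_cart)
    also have "\<dots> = (\<Sum>j\<in>UNIV. \<Sum>i\<in>UNIV. X $ i $ j)"
      by (subst sum.swap) (simp add: X)
    also have "\<dots> = real CARD('m)" by (simp add: X)
    finally show "norm X \<le> real CARD('m)" .
  qed
  ultimately show ?thesis by (simp add: compact_eq_bounded_closed)
qed

text \<open>Otherwise a hyperplane separates the origin from the deviations of the face from the
  egalitarian ray; its normal is a shift along which \<open>g\<close> decreases.\<close>

lemma egalitarian_leader_allocation:
  assumes opt: "declared_optimal a v"
  obtains X where "X \<in> leader_allocations v" "\<forall>i. alloc_value a X $ i = alloc_value a X $ 1"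
proof -
  have v: "v \<in> RNS_interior" using opt graph_verts_interior by (simp add: declared_optimal_def)
  \<comment> \<open>Deviation from the mean: linear in \<open>X\<close>, and 0 exactly when the
    three values agree.\<close>
  define dev where "dev X = (\<chi> i. alloc_value a X $ i - (\<Sum>k\<in>UNIV. alloc_value a X $ k) / 3)" for X
  have lin: "linear dev"
    by (rule linearI) (simp_all add: dev_def vec_eq_iff alloc_value_def sum.distrib
      sum_distrib_left algebra_simps add_divide_distrib sum_divide_distrib)
  have "convex (dev ` leader_allocations v)"
    using lin convex_leader_allocations by (rule convex_linear_image)
  moreover have "compact (dev ` leader_allocations v)"
    using linear_continuous_on[OF linear_conv_bounded_linear[THEN iffD1, OF lin]] compact_leader_allocations
    by (rule compact_continuous_image)
  then have "closed (dev ` leader_allocations v)" by (rule compact_imp_closed)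
  ultimately have "0 \<in> dev ` leader_allocations v"
  proof (rule_tac ccontr)
    assume K: "convex (dev ` leader_allocations v)" "closed (dev ` leader_allocations v)"
      "0 \<notin> dev ` leader_allocations v"
    obtain n b where n: "0 < b" "\<And>x. x \<in> dev ` leader_allocations v \<Longrightarrow> b < n \<bullet> x"
      using separating_hyperplane_closed_0[OF K] by metis
    \<comment> \<open>The negative of \<open>n\<close> projected to coordinate sum 0, as a shift
      must be. The projection does not affect products with \<open>dev X\<close>, whose coordinates
      sum to 0 as well. The allocation attaining \<open>delta_g a v s\<close> then has
      \<open>n \<bullet> dev X \<le> 0\<close>, against separation by the positive
      \<open>b\<close>.\<close>
    define s where "s = (\<chi> i. (\<Sum>k\<in>UNIV. n $ k) / 3 - n $ i)"
    have "(\<Sum>k\<in>UNIV. s $ k) = 0" by (simp add: s_def sum_subtractf)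
    then have "0 \<le> delta_g a v s" by (rule delta_g_nonneg[OF opt])
    moreover obtain X where X: "X \<in> leader_allocations v"
      "(\<Sum>i\<in>UNIV. s $ i * alloc_value a X $ i) = delta_g a v s"
      using leader_allocation_delta_g[OF v] .
    moreover have "n \<bullet> dev X = - (\<Sum>i\<in>UNIV. s $ i * alloc_value a X $ i)"
      by (simp add: inner_vec_def dev_def s_def sum_3 algebra_simps add_divide_distrib)
    ultimately show False using n(1) n(2)[of "dev X"] by force
  qed
  then obtain X where X: "X \<in> leader_allocations v" "dev X = 0" by auto
  have mean: "alloc_value a X $ i = (\<Sum>k\<in>UNIV. alloc_value a X $ k) / 3" for i
    using arg_cong[OF X(2), of "\<lambda>x. x $ i"] by (simp add: dev_def)
  have "\<forall>i. alloc_value a X $ i = alloc_value a X $ 1" by (intro allI trans[OF mean mean[symmetric]])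
  with X(1) show thesis by (rule that)
qed

end

text \<open>Ties make \<open>alg_step\<close> a relation, so termination is the absence of infinite
  runs under any choice among ties. The last conjunct is the End step.\<close>

theorem theorem9:
  fixes a :: "real^'m^3" and v0 :: "real^3"
  assumes "\<And>i. (\<Sum>j\<in>UNIV. a $ i $ j) = 1"
    and MAC: "\<And>i j. a $ i $ j > 0"
    and "v0 \<in> graph_verts a"
  shows "\<not> (\<exists>v. v 0 = v0 \<and> (\<forall>k::nat. alg_step a (v k) (v (Suc k)))) \<and>
    (\<forall>v. (alg_step a)\<^sup>*\<^sup>* v0 v \<and> \<not> (\<exists>w. alg_step a v w) \<longrightarrow>
       declared_optimal a v \<and>
       pareto_face a v \<inter> egalitarian_ray \<noteq> {} \<and>
       (\<forall>X. allocation X \<and> alloc_value a X \<in> pareto_face a v \<inter> egalitarian_ray \<longrightarrow>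
            optimal_allocation a X))"
proof -
  interpret positive_values a by (rule positive_values.intro) (rule MAC)
  have finite_run: "\<not> (\<exists>v. v 0 = v0 \<and> (\<forall>k::nat. alg_step a (v k) (v (Suc k))))"
  proof
    assume "\<exists>v. v 0 = v0 \<and> (\<forall>k::nat. alg_step a (v k) (v (Suc k)))"
    then obtain v where v: "v 0 = v0 \<and> (\<forall>k::nat. alg_step a (v k) (v (Suc k)))" ..
    show False
    proof (rule no_infinite_run)
      show "v 0 \<in> graph_verts a" using v assms(3) by simp
      show "alg_step a (v k) (v (Suc k))" for k using v by simp
    qed
  qed
  have final: "declared_optimal a v \<and> pareto_face a v \<inter> egalitarian_ray \<noteq> {} \<and>
       (\<forall>X. allocation X \<and> alloc_value a X \<in> pareto_face a v \<inter> egalitarian_ray \<longrightarrow>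
            optimal_allocation a X)"
    if run: "(alg_step a)\<^sup>*\<^sup>* v0 v" and stop: "\<nexists>w. alg_step a v w" for v
  proof (intro conjI allI impI)
    have vV: "v \<in> graph_verts a"
      using run
    proof (induction rule: rtranclp_induct)
      case base
      show ?case by (rule assms(3))
    next
      case (step u w)
      show ?case using step.hyps(2) by (rule alg_step_level_less(2))
    qed
    then have v: "v \<in> RNS_interior" by (rule graph_verts_interior)
    show opt: "declared_optimal a v" using vV stop by (rule declared_optimal_if_no_step)
    obtain X where X: "X \<in> leader_allocations v" "\<forall>i. alloc_value a X $ i = alloc_value a X $ 1"
      using egalitarian_leader_allocation[OF opt] .
    have "alloc_value a X = (\<chi> i. alloc_value a X $ 1)"
      unfolding vec_eq_iff vec_lambda_beta by (rule X(2))
    moreover have "0 \<le> alloc_value a X $ 1"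
      unfolding alloc_value_def using X(1) value_pos
      by (simp add: leader_allocations_def allocation_def less_imp_le sum_nonneg)
    ultimately have "alloc_value a X \<in> egalitarian_ray"
      unfolding egalitarian_ray_def by (intro CollectI exI[of _ "alloc_value a X $ 1"] conjI)
    then show "pareto_face a v \<inter> egalitarian_ray \<noteq> {}"
      using leader_allocation_in_face[OF v X(1)] by auto
    fix Y assume Y: "allocation Y \<and> alloc_value a Y \<in> pareto_face a v \<inter> egalitarian_ray"
    then have "pareto_optimal a Y" by (intro pareto_optimal_if_in_face[OF v]) simp_all
    then show "optimal_allocation a Y"
      using Y by (auto simp: optimal_allocation_def egalitarian_ray_def)
  qed
  show ?thesis
    by (intro conjI[OF finite_run] allI impI, elim conjE, rule final)
qed

end
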